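(* Let $\Omega, E, f, m$ be as in the context, i.e. $E(x,u)\ge 0$ on $\overline\Omega\times[0,\infty)$, $m>0$ on $\overline\Omega$, $E(x,m(x))=0$ on $\Omega$, $E_u=-f$ on $\Omega\times(0,\infty)$ and $f_u<0$ on $\overline\Omega\times(0,\infty)$. Let $U$ be a uniformly integrable set of smooth probability measures on $\overline\Omega$. Then there is a constant $C$, which may depend on $U$ but is independent of $u$ and $a$, such that for all $u\in U$ and all $a\in\mathbb R$ $$\int_\Omega E(x,u(x))\,dx\le C\left[\int_\Omega u(x)\,(f(x,u(x))-a)^2\,dx+\int_\Omega u(x)\,|\nabla f(x,u(x))|^2\,dx\right].$$
   Context: $\Omega$ is either an open connected bounded domain in $\mathbb R^d$ with sufficiently smooth boundary, or the flat torus $\mathbb T^d$. Fixed are functions $E\in C(\overline\Omega\times[0,\infty))$, $f\in C^1(\overline\Omega\times(0,\infty))$ and a probability density $m\in C(\overline\Omega)$ (so $\int_\Omega m\,dx=1$) such that: $E(x,u)\ge0$ for $(x,u)\in\overline\Omega\times[0,\infty)$; $m(x)>0$ for $x\in\overline\Omega$; $E(x,m(x))=0$ for $x\in\Omega$; $E_u(x,u)=-f(x,u)$ for $(x,u)\in\Omega\times(0,\infty)$; $f_u(x,u)<0$ for $(x,u)\in\overline\Omega\times(0,\infty)$. Smooth probability measures are identified with their smooth densities $u\ge0$, $\int_\Omega u\,dx=1$. A set $U$ of integrable functions is uniformly integrable if $\lim_{\delta\to+0}\sup\{\int_A|u|\,dx: u\in U,\ A\subset\Omega,\ |A|\le\delta\}=0$,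 where $|A|$ is Lebesgue measure. $\nabla f(x,u(x))$ is the full gradient of the composite function $x\mapsto f(x,u(x))$. Integrands containing the factor $u$ and the function $f(x,u(x))$ are understood to be $0$ at points where $u(x)=0$ (where $f$ need not be defined). *)

theory Defs
  imports "HOL-Analysis.Analysis"
begin

(* A function of class C^k on S, where S may be closed (k-fold continuous differentiability up to
   the boundary): derivatives are taken relative to S.  For closures of C^1 domains and products of
   these with open intervals the derivative relative to S is unique. *)
primrec Ck_on :: "nat \<Rightarrow> 'a::euclidean_space set \<Rightarrow> ('a \<Rightarrow> real) \<Rightarrow> bool" where
  "Ck_on 0 S g \<longleftrightarrow> continuous_on S g"
| "Ck_on (Suc k) S g \<longleftrightarrow>
     (\<exists>G. (\<forall>z\<in>S. (g has_derivative (\<lambda>h. G z \<bullet> h)) (at z within S)) \<and>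
          (\<forall>b\<in>Basis. Ck_on k S (\<lambda>z. G z \<bullet> b)))"

definition smooth_on :: "'a::euclidean_space set \<Rightarrow> ('a \<Rightarrow> real) \<Rightarrow> bool" where
  "smooth_on S g \<longleftrightarrow> (\<forall>k. Ck_on k S g)"

(* Near every boundary point the set is, in suitable orthonormal coordinates with last axis \<nu>,
   the strict epigraph of a C^1 function g of the remaining coordinates.  The point
   x - (x \<bullet> \<nu>) *\<^sub>R \<nu> is the orthogonal projection of x to the hyperplane orthogonal to \<nu>;
   only the restriction of g to this hyperplane matters. *)
definition C1_boundary :: "'a::euclidean_space set \<Rightarrow> bool" where
  "C1_boundary \<Omega> \<longleftrightarrow>
     (\<forall>p\<in>frontier \<Omega>. \<exists>r>0. \<exists>\<nu> g. norm \<nu> = 1 \<and> Ck_on 1 UNIV g \<and>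
        \<Omega> \<inter> ball p r = {x \<in> ball p r. g (x - (x \<bullet> \<nu>) *\<^sub>R \<nu>) < x \<bullet> \<nu>})"

definition bounded_C1_domain :: "'a::euclidean_space set \<Rightarrow> bool" where
  "bounded_C1_domain \<Omega> \<longleftrightarrow>
     open \<Omega> \<and> connected \<Omega> \<and> bounded \<Omega> \<and> \<Omega> \<noteq> {} \<and> C1_boundary \<Omega>"

(* The ambient space is a domain in R^d or the flat torus R^d / Z^d.  Functions on the torus are
   functions on R^d that are invariant under translations by Z^d. *)
datatype 'a region = Domain "'a set" | Torus

primrec admissible :: "(real^'n) region \<Rightarrow> bool" where
  "admissible (Domain \<Omega>) \<longleftrightarrow> bounded_C1_domain \<Omega>"
| "admissible Torus \<longleftrightarrow> True"

(* points of \<Omega>; for the torus, all representatives in R^d *)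
primrec pts :: "(real^'n) region \<Rightarrow> (real^'n) set" where
  "pts (Domain \<Omega>) = \<Omega>"
| "pts Torus = UNIV"

(* The region of integration; for the torus a set of unique representatives modulo Z^d, so that
   measurable subsets of the torus are the measurable subsets of it. *)
primrec cell :: "(real^'n) region \<Rightarrow> (real^'n) set" where
  "cell (Domain \<Omega>) = \<Omega>"
| "cell Torus = {x. \<forall>i. 0 \<le> x $ i \<and> x $ i < 1}"

primrec descends :: "(real^'n) region \<Rightarrow> (real^'n \<Rightarrow> 'b) \<Rightarrow> bool" where
  "descends (Domain \<Omega>) g \<longleftrightarrow> True"
| "descends Torus g \<longleftrightarrow> (\<forall>x k. (\<forall>i. k $ i \<in> \<int>) \<longrightarrow> g (x + k) = g x)"

definition smooth_density :: "(real^'n) region \<Rightarrow> (real^'n \<Rightarrow> real) \<Rightarrow> bool" where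
  "smooth_density R u \<longleftrightarrow>
     descends R u \<and> smooth_on (closure (pts R)) u \<and> (\<forall>x\<in>closure (pts R). 0 \<le> u x) \<and>
     (LINT x:cell R|lebesgue. u x) = 1"

definition uniformly_integrable :: "(real^'n) region \<Rightarrow> (real^'n \<Rightarrow> real) set \<Rightarrow> bool" where
  "uniformly_integrable R U \<longleftrightarrow>
     ((\<lambda>\<delta>::real. Sup {\<integral>\<^sup>+x\<in>A. ennreal \<bar>u x\<bar> \<partial>lebesgue | u A.
          u \<in> U \<and> A \<in> sets lebesgue \<and> A \<subseteq> cell R \<and> emeasure lebesgue A \<le> ennreal \<delta>})
       \<longlongrightarrow> 0) (at_right 0)"

definition grad :: "('a::real_inner \<Rightarrow> real) \<Rightarrow> 'a \<Rightarrow> 'a" where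
  "grad g x = (THE D. GDERIV g x :> D)"

end

theory Submission
  imports Defs
begin

text \<open>
  Since \<open>m x > 0\<close> is an interior minimum of \<open>E x\<close>, the decreasing function \<open>f x\<close> vanishes exactly at
  \<open>m x\<close>. Hence \<open>\<phi> x = f x (u x)\<close> measures how far \<open>u\<close> is from \<open>m\<close>, and \<open>E x (u x)\<close> is at most of
  the order \<open>(1 + u) \<phi>\<^sup>2\<close> as long as \<open>u\<close> stays away from \<open>0\<close>. The difficulty is that both terms on the right carry the
  weight \<open>u\<close> and so do not see the region where \<open>u\<close> is small, while \<open>E\<close> does.

  The remedy is to truncate \<open>\<phi>\<close> from above. For suitable constants \<open>K, c > 0\<close> one has \<open>f x s \<ge> K\<close> whenever
  \<open>s \<le> c\<close>. Let \<open>T\<close> be a contraction of class \<open>C\<^sup>1\<close> with \<open>T s = s\<close> for \<open>s \<le> 0\<close> that is constant on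
  \<open>[K, \<infinity>)\<close>, and put \<open>g = T \<circ> \<phi>\<close>, continued by this constant to the zeros of \<open>u\<close>. Then \<open>g\<close> is of class
  \<open>C\<^sup>1\<close>, its gradient vanishes where \<open>u \<le> c\<close>, and therefore \<open>c |\<nabla>g|\<^sup>2 \<le> u |\<nabla>\<phi>|\<^sup>2\<close>: the weighted
  Dirichlet integral of \<open>\<phi>\<close> controls the unweighted one of \<open>g\<close> (\<open>truncated_f_C1_fun\<close>). With \<open>b = T a\<close>, the
  proof combines three facts about \<open>W = \<integral> (1 + u) (g - b)\<^sup>2\<close>.

  First, \<open>W\<close> is bounded by the right-hand side. By uniform integrability every \<open>u\<close> in \<open>U\<close> exceeds a fixed
  level on a set of at least a fixed measure (\<open>superlevel_large\<close>); there \<open>\<integral> u (g - b)\<^sup>2\<close>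
  controls \<open>g - b\<close> without the weight, and the Poincare inequality spreads this control over the whole
  domain (\<open>weighted_poincare\<close>).

  Secondly, \<open>b\<^sup>2\<close> is bounded by a multiple of \<open>W\<close>, because \<open>u\<close> and \<open>m\<close> have the same mass: there is a
  pointwise inequality \<open>|b| \<le> B (1 + u) |g - b| + k (u - m)\<close> with \<open>B\<close> independent of \<open>b\<close>, and its last
  term integrates to \<open>0\<close> (\<open>comparable_level\<close>). The function \<open>T\<close> is not truncated from below in order to
  keep \<open>B\<close> independent of \<open>a\<close> also as \<open>a\<close> tends to \<open>-\<infinity>\<close>.

  Thirdly, \<open>E x (u x) \<le> C (1 + u x) (g x)\<^sup>2\<close> (\<open>truncated_f_comparable\<close>), and
  \<open>\<integral> (1 + u) g\<^sup>2 \<le> 2 W + 2 b\<^sup>2 (|\<Omega>| + 1)\<close>.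

  The Poincare inequality is proved in the form
  \<open>\<integral>\<^sub>V \<integral>\<^sub>S (g x - g y)\<^sup>2 \<le> C \<integral>\<^sub>\<Omega> |\<nabla>g|\<^sup>2\<close> for pairs of sets \<open>V, S\<close>. It holds as soon as all segments from
  \<open>V\<close> to \<open>S\<close> stay in \<open>\<Omega>\<close>, and it can be chained through open sets; connectedness and compactness then
  give it for \<open>V = S = \<Omega>\<close>. The torus is reduced to the open unit cube, from which its cell differs
  by a null set.
\<close>

section \<open>The Poincare inequality for pairs of sets\<close>

text \<open>Measurability is required on the whole space, so that Borel sets other than \<open>\<Omega>\<close> can be integrated over;
a \<open>C\<^sup>1\<close> function on an open set is of this kind after it has been set to \<open>0\<close> outside.\<close>

definition C1_fun :: "'a::euclidean_space set \<Rightarrow> ('a \<Rightarrow> real) \<Rightarrow> ('a \<Rightarrow> 'a) \<Rightarrow> bool" where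
  "C1_fun \<Omega> g G \<longleftrightarrow> g \<in> borel_measurable borel \<and> G \<in> borel_measurable borel \<and>
     continuous_on \<Omega> G \<and> (\<forall>x\<in>\<Omega>. (g has_derivative (\<lambda>h. G x \<bullet> h)) (at x))"

definition energy :: "'a::euclidean_space set \<Rightarrow> ('a \<Rightarrow> 'a) \<Rightarrow> ennreal" where
  "energy \<Omega> G = (\<integral>\<^sup>+z\<in>\<Omega>. ennreal ((norm (G z))\<^sup>2) \<partial>lborel)"

definition variation :: "'a::euclidean_space set \<Rightarrow> 'a set \<Rightarrow> ('a \<Rightarrow> real) \<Rightarrow> ennreal" where
  "variation V W g = (\<integral>\<^sup>+x\<in>V. (\<integral>\<^sup>+y\<in>W. ennreal ((g x - g y)\<^sup>2) \<partial>lborel) \<partial>lborel)"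

text \<open>A Poincare inequality between \<open>V\<close> and \<open>W\<close> with energy taken over \<open>\<Omega>\<close>. For \<open>V = W = \<Omega>\<close> it is the usual one,
because \<open>\<integral>\<integral> (g x - g y)\<^sup>2\<close> is twice the measure of \<open>\<Omega>\<close> times the variance integral of \<open>g\<close>. Admitting two sets makes
the property transitive, hence accessible to chaining arguments.\<close>

definition linked :: "'a::euclidean_space set \<Rightarrow> 'a set \<Rightarrow> 'a set \<Rightarrow> bool" where
  "linked \<Omega> V W \<longleftrightarrow>
     (\<exists>C::real. \<forall>g G. C1_fun \<Omega> g G \<longrightarrow> variation V W g \<le> ennreal C * energy \<Omega> G)"

text \<open>The fundamental theorem of calculus along the segment, followed by Jensen's inequality on \<open>[0, 1]\<close>.\<close>

lemma sq_diff_le_segment: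
  fixes g :: "'a::euclidean_space \<Rightarrow> real"
  assumes C1: "C1_fun \<Omega> g G" and seg: "closed_segment x y \<subseteq> \<Omega>"
  shows "ennreal ((g x - g y)\<^sup>2) \<le>
    (\<integral>\<^sup>+t\<in>{0..1}. ennreal ((norm (x - y))\<^sup>2 * (norm (G ((1 - t) *\<^sub>R x + t *\<^sub>R y)))\<^sup>2) \<partial>lborel)"
proof -
  define p where "p t = (1 - t) *\<^sub>R x + t *\<^sub>R y" for t
  define c where "c = g y - g x"
  have p_in: "p t \<in> \<Omega>" if "t \<in> {0..1}" for t
    using seg that unfolding p_def by (auto simp: closed_segment_def subset_iff)
  have p_der: "(p has_derivative (\<lambda>s. s *\<^sub>R (y - x))) (at t within {0..1})" for t
    unfolding p_def by (auto intro!: derivative_eq_intros simp: algebra_simps)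
  have p_cont: "continuous_on {0..1} p"
    unfolding p_def by (intro continuous_intros)
  have G_cont: "continuous_on {0..1} (\<lambda>t. G (p t))"
  proof (rule continuous_on_compose2[OF _ p_cont])
    show "continuous_on \<Omega> G" using C1 by (simp add: C1_fun_def)
  qed (use p_in in blast)
  have "((\<lambda>t. g (p t)) has_vector_derivative (G (p t) \<bullet> (y - x))) (at t within {0..1})"
    if t: "t \<in> {0..1}" for t
  proof -
    have "(g has_derivative (\<lambda>h. G (p t) \<bullet> h)) (at (p t))"
      using C1 p_in[OF t] by (simp add: C1_fun_def)
    from has_derivative_compose[OF p_der this]
    show ?thesis unfolding has_vector_derivative_def by simp
  qed
  then have "((\<lambda>t. G (p t) \<bullet> (y - x)) has_integral (g (p 1) - g (p 0))) {0..1}"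
    by (intro fundamental_theorem_of_calculus) auto
  then have I1: "((\<lambda>t. G (p t) \<bullet> (y - x)) has_integral c) {0..1}"
    by (simp add: p_def c_def)
  \<comment> \<open>Jensen: \<open>2 c r - c\<^sup>2 \<le> r\<^sup>2\<close> for \<open>r = G (p t) \<bullet> (y - x)\<close>, and the left side integrates to \<open>c\<^sup>2\<close>.\<close>
  have "((\<lambda>t. (2 * c) * (G (p t) \<bullet> (y - x)) - c\<^sup>2) has_integral ((2 * c) * c - c\<^sup>2)) {0..1}"
    using has_integral_diff[OF has_integral_mult_right[OF I1, of "2*c"] has_integral_const_real[of "c\<^sup>2" 0 1]]
    by simp
  then have I2: "((\<lambda>t. (2 * c) * (G (p t) \<bullet> (y - x)) - c\<^sup>2) has_integral c\<^sup>2) {0..1}"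
    by (simp add: power2_eq_square)
  have "continuous_on {0..1} (\<lambda>t. (norm (x - y))\<^sup>2 * (norm (G (p t)))\<^sup>2)"
    by (intro continuous_intros G_cont)
  then obtain I where I: "((\<lambda>t. (norm (x - y))\<^sup>2 * (norm (G (p t)))\<^sup>2) has_integral I) {0..1}"
    using integrable_continuous_real unfolding integrable_on_def by blast
  have pw: "(2 * c) * (G (p t) \<bullet> (y - x)) - c\<^sup>2 \<le> (norm (x - y))\<^sup>2 * (norm (G (p t)))\<^sup>2" for t
  proof -
    have "(G (p t) \<bullet> (y - x))\<^sup>2 \<le> (norm (x - y))\<^sup>2 * (norm (G (p t)))\<^sup>2"
      using Cauchy_Schwarz_ineq[of "G (p t)" "y - x"]
      by (simp add: power2_norm_eq_inner norm_minus_commute[of x y] mult.commute)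
    moreover have "(2 * c) * (G (p t) \<bullet> (y - x)) - c\<^sup>2 \<le> (G (p t) \<bullet> (y - x))\<^sup>2"
      using zero_le_power2[of "G (p t) \<bullet> (y - x) - c"] by (simp add: power2_diff mult_ac)
    ultimately show ?thesis by linarith
  qed
  have "c\<^sup>2 \<le> I" using has_integral_le[OF I2 I] pw by auto
  then have "ennreal ((g x - g y)\<^sup>2) \<le> ennreal I"
    by (intro ennreal_leI) (simp add: c_def power2_commute)
  also have "\<dots> = (\<integral>\<^sup>+t\<in>{0..1}. ennreal ((norm (x - y))\<^sup>2 * (norm (G (p t)))\<^sup>2) \<partial>lborel)"
    by (rule nn_integral_has_integral_lebesgue'[symmetric, OF _ I]) auto
  finally show ?thesis by (simp add: p_def)
qed

text \<open>The restriction to factors of at least \<open>1/2\<close> makes the Jacobian factor uniform.\<close>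

lemma nn_integral_affine:
  fixes H :: "'a::euclidean_space \<Rightarrow> ennreal"
  assumes [measurable]: "H \<in> borel_measurable borel" and c: "1/2 \<le> c"
  shows "(\<integral>\<^sup>+x. H (a + c *\<^sub>R x) \<partial>lborel) \<le> ennreal (2 ^ DIM('a)) * (\<integral>\<^sup>+x. H x \<partial>lborel)"
proof -
  have c0: "c \<noteq> 0" "0 < c" using c by auto
  have "(\<integral>\<^sup>+x. H x \<partial>lborel) = ennreal (\<bar>c\<bar>^DIM('a)) * (\<integral>\<^sup>+x. H (a + c *\<^sub>R x) \<partial>lborel)"
    by (subst lborel_affine[OF c0(1), of a])
       (simp add: nn_integral_density nn_integral_distr nn_integral_cmult)
  then have "ennreal (2 ^ DIM('a)) * (\<integral>\<^sup>+x. H x \<partial>lborel) =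
      ennreal (2 ^ DIM('a) * \<bar>c\<bar>^DIM('a)) * (\<integral>\<^sup>+x. H (a + c *\<^sub>R x) \<partial>lborel)"
    by (simp add: ennreal_mult mult.assoc)
  also have "\<dots> \<ge> 1 * (\<integral>\<^sup>+x. H (a + c *\<^sub>R x) \<partial>lborel)"
  proof (intro mult_right_mono)
    have "1 \<le> (2 * c) ^ DIM('a)" using c by (intro one_le_power) auto
    then show "1 \<le> ennreal (2 ^ DIM('a) * \<bar>c\<bar>^DIM('a))" using c0
      by (simp add: power_mult_distrib ennreal_1[symmetric] del: ennreal_1)
  qed simp
  finally show ?thesis by simp
qed

text \<open>By the bound on segments, \<open>\<integral>\<^sub>V \<integral>\<^sub>W (g x - g y)\<^sup>2\<close> is at most a constant times the integral over
\<open>t \<in> [0, 1]\<close> and \<open>x \<in> V, y \<in> W\<close> of \<open>|G|\<^sup>2\<close> at \<open>(1 - t) x + t y\<close>. For fixed \<open>t\<close> one of the weights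
\<open>1 - t\<close> and \<open>t\<close> is at least \<open>1/2\<close>; integrating first over the corresponding variable and
substituting costs a factor of at most \<open>2 ^ DIM('a)\<close>.\<close>

lemma linked_segments:
  fixes \<Omega> :: "'a::euclidean_space set"
  assumes \<Omega>: "\<Omega> \<in> sets borel" "bounded \<Omega>"
    and VW: "V \<in> sets borel" "W \<in> sets borel"
    and seg: "\<And>x y. x \<in> V \<Longrightarrow> y \<in> W \<Longrightarrow> closed_segment x y \<subseteq> \<Omega>"
  shows "linked \<Omega> V W"
proof (cases "V = {} \<or> W = {}")
  case True
  then show ?thesis unfolding linked_def variation_def
    by (intro exI[of _ 0]) auto
next
  case False
  note [measurable] = \<Omega>(1) VW
  have sub: "V \<subseteq> \<Omega>" "W \<subseteq> \<Omega>" using seg False by fastforce+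
  have bd: "bounded V" "bounded W" using sub \<Omega>(2) bounded_subset by auto
  define \<mu> where "\<mu> = measure lborel V + measure lborel W"
  have em: "emeasure lborel V = ennreal (measure lborel V)" "emeasure lborel W = ennreal (measure lborel W)"
    using emeasure_bounded_finite[OF bd(1)] emeasure_bounded_finite[OF bd(2)]
    by (auto intro!: emeasure_eq_ennreal_measure)
  obtain d where d: "\<And>x y. x \<in> \<Omega> \<Longrightarrow> y \<in> \<Omega> \<Longrightarrow> norm (x - y) \<le> d" "0 \<le> d"
  proof
    show "norm (x - y) \<le> diameter \<Omega>" if "x \<in> \<Omega>" "y \<in> \<Omega>" for x y
      using diameter_bounded_bound[OF \<Omega>(2) that] by (simp add: dist_norm)
    show "0 \<le> diameter \<Omega>" by (rule diameter_ge_0[OF \<Omega>(2)])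
  qed
  show ?thesis unfolding linked_def
  proof (intro exI allI impI)
    fix g G assume C1: "C1_fun \<Omega> g G"
    have [measurable]: "g \<in> borel_measurable borel" "G \<in> borel_measurable borel"
      using C1 by (auto simp: C1_fun_def)
    define H where "H z = ennreal ((norm (G z))\<^sup>2) * indicator \<Omega> z" for z
    have [measurable]: "H \<in> borel_measurable borel" unfolding H_def by measurable
    have en: "energy \<Omega> G = (\<integral>\<^sup>+z. H z \<partial>lborel)" by (simp add: energy_def H_def)
    define J where "J t x y = H ((1 - t) *\<^sub>R x + t *\<^sub>R y) * indicator V x * indicator W y" for t x y
    have J_meas[measurable]: "(\<lambda>(t, x, y). J t x y) \<in> borel_measurable (borel \<Otimes>\<^sub>M borel \<Otimes>\<^sub>M borel)"
      unfolding J_def by measurable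
    have pw: "ennreal ((g x - g y)\<^sup>2) * indicator W y * indicator V x \<le>
        ennreal (d\<^sup>2) * (\<integral>\<^sup>+t\<in>{0..1}. J t x y \<partial>lborel)" for x y
    proof (cases "x \<in> V \<and> y \<in> W")
      case True
      have inO: "(1 - t) *\<^sub>R x + t *\<^sub>R y \<in> \<Omega>" if "t \<in> {0..1}" for t
        using seg[of x y] True that by (auto simp: closed_segment_def subset_iff)
      have "ennreal ((g x - g y)\<^sup>2) \<le>
          (\<integral>\<^sup>+t\<in>{0..1}. ennreal ((norm (x - y))\<^sup>2 * (norm (G ((1 - t) *\<^sub>R x + t *\<^sub>R y)))\<^sup>2) \<partial>lborel)"
        using sq_diff_le_segment[OF C1] seg True by blast
      also have "\<dots> \<le> (\<integral>\<^sup>+t. ennreal (d\<^sup>2) * (J t x y * indicator {0..1} t) \<partial>lborel)"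
      proof (intro nn_integral_mono)
        fix t :: real
        have "(norm (x - y))\<^sup>2 \<le> d\<^sup>2" using d sub True by (intro power_mono) auto
        then show "ennreal ((norm (x - y))\<^sup>2 * (norm (G ((1 - t) *\<^sub>R x + t *\<^sub>R y)))\<^sup>2) * indicator {0..1} t
            \<le> ennreal (d\<^sup>2) * (J t x y * indicator {0..1} t)"
          using True inO[of t] unfolding J_def H_def
          by (auto simp: indicator_def ennreal_mult[symmetric] intro!: ennreal_leI mult_right_mono)
      qed
      also have "\<dots> = ennreal (d\<^sup>2) * (\<integral>\<^sup>+t\<in>{0..1}. J t x y \<partial>lborel)"
        unfolding J_def by (intro nn_integral_cmult) measurable
      finally show ?thesis using True by simp
    qed auto
    have "variation V W g \<le> (\<integral>\<^sup>+x. (\<integral>\<^sup>+y. ennreal (d\<^sup>2) * (\<integral>\<^sup>+t\<in>{0..1}. J t x y \<partial>lborel) \<partial>lborel) \<partial>lborel)"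
      unfolding variation_def
    proof (intro nn_integral_mono)
      fix x
      have "(\<integral>\<^sup>+y\<in>W. ennreal ((g x - g y)\<^sup>2) \<partial>lborel) * indicator V x =
          (\<integral>\<^sup>+y. ennreal ((g x - g y)\<^sup>2) * indicator W y * indicator V x \<partial>lborel)"
        by (intro nn_integral_multc[symmetric]) measurable
      also have "\<dots> \<le> (\<integral>\<^sup>+y. ennreal (d\<^sup>2) * (\<integral>\<^sup>+t\<in>{0..1}. J t x y \<partial>lborel) \<partial>lborel)"
        by (intro nn_integral_mono pw)
      finally show "(\<integral>\<^sup>+y\<in>W. ennreal ((g x - g y)\<^sup>2) \<partial>lborel) * indicator V x \<le>
          (\<integral>\<^sup>+y. ennreal (d\<^sup>2) * (\<integral>\<^sup>+t\<in>{0..1}. J t x y \<partial>lborel) \<partial>lborel)" .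
    qed
    also have "\<dots> = ennreal (d\<^sup>2) * (\<integral>\<^sup>+x. (\<integral>\<^sup>+y. (\<integral>\<^sup>+t\<in>{0..1}. J t x y \<partial>lborel) \<partial>lborel) \<partial>lborel)"
      unfolding J_def by (simp add: nn_integral_cmult)
    also have "(\<integral>\<^sup>+x. (\<integral>\<^sup>+y. (\<integral>\<^sup>+t\<in>{0..1}. J t x y \<partial>lborel) \<partial>lborel) \<partial>lborel) =
        (\<integral>\<^sup>+x. (\<integral>\<^sup>+t. (\<integral>\<^sup>+y. J t x y * indicator {0..1} t \<partial>lborel) \<partial>lborel) \<partial>lborel)"
      unfolding J_def by (intro nn_integral_cong lborel_pair.Fubini') measurable
    also have "\<dots> = (\<integral>\<^sup>+t. (\<integral>\<^sup>+x. (\<integral>\<^sup>+y. J t x y * indicator {0..1} t \<partial>lborel) \<partial>lborel) \<partial>lborel)"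
      unfolding J_def by (intro lborel_pair.Fubini') measurable
    also have "\<dots> \<le> (\<integral>\<^sup>+t::real\<in>{0..1}. ennreal (2 ^ DIM('a) * \<mu>) * energy \<Omega> G \<partial>lborel)"
    proof (intro nn_integral_mono)
      fix t :: real
      have A: "(\<integral>\<^sup>+x. (\<integral>\<^sup>+y. J t x y \<partial>lborel) \<partial>lborel) \<le> ennreal (2 ^ DIM('a) * \<mu>) * energy \<Omega> G"
        if t: "0 \<le> t" "t \<le> 1"
      proof (cases "t \<le> 1/2")
        case True
        \<comment> \<open>Here the weight of \<open>x\<close> is at least \<open>1/2\<close>, so the integral over \<open>x\<close> is moved inside.\<close>
        have "(\<integral>\<^sup>+x. (\<integral>\<^sup>+y. J t x y \<partial>lborel) \<partial>lborel) = (\<integral>\<^sup>+y. (\<integral>\<^sup>+x. J t x y \<partial>lborel) \<partial>lborel)"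
          unfolding J_def by (intro lborel_pair.Fubini') measurable
        also have "\<dots> \<le> (\<integral>\<^sup>+y. (\<integral>\<^sup>+x. H (t *\<^sub>R y + (1 - t) *\<^sub>R x) \<partial>lborel) * indicator W y \<partial>lborel)"
          by (intro nn_integral_mono, subst nn_integral_multc[symmetric], measurable, intro nn_integral_mono)
             (auto simp: J_def indicator_def add.commute)
        also have "\<dots> \<le> (\<integral>\<^sup>+y. (ennreal (2 ^ DIM('a)) * energy \<Omega> G) * indicator W y \<partial>lborel)"
          unfolding en using True by (intro nn_integral_mono mult_right_mono nn_integral_affine) auto
        also have "\<dots> = (ennreal (2 ^ DIM('a)) * energy \<Omega> G) * ennreal (measure lborel W)"
          by (simp add: nn_integral_cmult_indicator em)
        also have "\<dots> \<le> (ennreal (2 ^ DIM('a)) * energy \<Omega> G) * ennreal \<mu>"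
          by (intro mult_left_mono ennreal_leI) (auto simp: \<mu>_def)
        finally show ?thesis by (simp add: ennreal_mult \<mu>_def mult_ac)
      next
        case False
        have "(\<integral>\<^sup>+x. (\<integral>\<^sup>+y. J t x y \<partial>lborel) \<partial>lborel) \<le>
            (\<integral>\<^sup>+x. (\<integral>\<^sup>+y. H ((1 - t) *\<^sub>R x + t *\<^sub>R y) \<partial>lborel) * indicator V x \<partial>lborel)"
          by (intro nn_integral_mono, subst nn_integral_multc[symmetric], measurable, intro nn_integral_mono)
             (auto simp: J_def indicator_def)
        also have "\<dots> \<le> (\<integral>\<^sup>+x. (ennreal (2 ^ DIM('a)) * energy \<Omega> G) * indicator V x \<partial>lborel)"
          unfolding en using False by (intro nn_integral_mono mult_right_mono nn_integral_affine) auto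
        also have "\<dots> = (ennreal (2 ^ DIM('a)) * energy \<Omega> G) * ennreal (measure lborel V)"
          by (simp add: nn_integral_cmult_indicator em)
        also have "\<dots> \<le> (ennreal (2 ^ DIM('a)) * energy \<Omega> G) * ennreal \<mu>"
          by (intro mult_left_mono ennreal_leI) (auto simp: \<mu>_def)
        finally show ?thesis by (simp add: ennreal_mult \<mu>_def mult_ac)
      qed
      show "(\<integral>\<^sup>+x. (\<integral>\<^sup>+y. J t x y * indicator {0..1} t \<partial>lborel) \<partial>lborel) \<le>
          (ennreal (2 ^ DIM('a) * \<mu>) * energy \<Omega> G) * indicator {0..1} t"
        using A by (cases "t \<in> {0..1}") auto
    qed
    also have "\<dots> = ennreal (2 ^ DIM('a) * \<mu>) * energy \<Omega> G"
      by (simp add: nn_integral_cmult_indicator)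
    finally have "variation V W g \<le> ennreal (d\<^sup>2) * (ennreal (2 ^ DIM('a) * \<mu>) * energy \<Omega> G)"
      by (simp add: mult_left_mono)
    then show "variation V W g \<le> ennreal (d\<^sup>2 * (2 ^ DIM('a) * \<mu>)) * energy \<Omega> G"
      by (simp add: ennreal_mult \<mu>_def mult.assoc)
  qed
qed

text \<open>The constant in \<open>linked\<close> may be negative, since \<open>ennreal\<close> maps negative numbers to \<open>0\<close>; sums of constants
need it to be nonnegative.\<close>

lemma linked_nonneg_const:
  assumes "linked \<Omega> V W"
  shows "\<exists>C\<ge>0. \<forall>g G. C1_fun \<Omega> g G \<longrightarrow> variation V W g \<le> ennreal C * energy \<Omega> G"
proof -
  obtain C :: real where C: "\<forall>g G. C1_fun \<Omega> g G \<longrightarrow> variation V W g \<le> ennreal C * energy \<Omega> G"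
    using assms unfolding linked_def by blast
  show ?thesis
  proof (intro exI[of _ "max 0 C"] conjI allI impI)
    show "variation V W g \<le> ennreal (max 0 C) * energy \<Omega> G" if "C1_fun \<Omega> g G" for g G
      using C[rule_format, OF that] by (cases "C \<ge> 0") (auto simp: max_def ennreal_neg)
  qed simp
qed

lemma linked_mono:
  assumes "linked \<Omega> V W" "V' \<subseteq> V" "W' \<subseteq> W"
  shows "linked \<Omega> V' W'"
proof -
  have "variation V' W' g \<le> variation V W g" for g
    using assms(2,3) unfolding variation_def
    by (intro nn_integral_mono mult_mono) (auto simp: indicator_def)
  then show ?thesis using assms(1) unfolding linked_def by (meson order_trans)
qed

lemma linked_sym:
  assumes "linked \<Omega> V W" and [measurable]: "V \<in> sets borel" "W \<in> sets borel"
  shows "linked \<Omega> W V"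
proof -
  have "variation W V g = variation V W g" if [measurable]: "g \<in> borel_measurable borel" for g
  proof -
    have "variation W V g = (\<integral>\<^sup>+x. (\<integral>\<^sup>+y. ennreal ((g x - g y)\<^sup>2) * indicator V y * indicator W x \<partial>lborel) \<partial>lborel)"
      unfolding variation_def by (intro nn_integral_cong nn_integral_multc[symmetric]) measurable
    also have "\<dots> = (\<integral>\<^sup>+y. (\<integral>\<^sup>+x. ennreal ((g x - g y)\<^sup>2) * indicator V y * indicator W x \<partial>lborel) \<partial>lborel)"
      by (intro lborel_pair.Fubini') measurable
    also have "\<dots> = (\<integral>\<^sup>+y. (\<integral>\<^sup>+x. ennreal ((g y - g x)\<^sup>2) * indicator W x * indicator V y \<partial>lborel) \<partial>lborel)"
      by (simp add: power2_commute mult_ac)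
    also have "\<dots> = variation V W g"
      unfolding variation_def by (intro nn_integral_cong nn_integral_multc) measurable
    finally show ?thesis .
  qed
  then show ?thesis using assms(1) unfolding linked_def C1_fun_def by metis
qed

lemma linked_Un:
  assumes "linked \<Omega> V W" "linked \<Omega> V' W"
    and [measurable]: "V \<in> sets borel" "V' \<in> sets borel" "W \<in> sets borel"
  shows "linked \<Omega> (V \<union> V') W"
proof -
  obtain C where C: "0 \<le> C" "\<forall>g G. C1_fun \<Omega> g G \<longrightarrow> variation V W g \<le> ennreal C * energy \<Omega> G"
    using linked_nonneg_const[OF assms(1)] by blast
  obtain C' where C': "0 \<le> C'" "\<forall>g G. C1_fun \<Omega> g G \<longrightarrow> variation V' W g \<le> ennreal C' * energy \<Omega> G"
    using linked_nonneg_const[OF assms(2)] by blast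
  show ?thesis unfolding linked_def
  proof (intro exI allI impI)
    fix g G assume C1: "C1_fun \<Omega> g G"
    then have [measurable]: "g \<in> borel_measurable borel" by (simp add: C1_fun_def)
    have "variation (V \<union> V') W g \<le> (\<integral>\<^sup>+x. (\<integral>\<^sup>+y\<in>W. ennreal ((g x - g y)\<^sup>2) \<partial>lborel) * indicator V x +
        (\<integral>\<^sup>+y\<in>W. ennreal ((g x - g y)\<^sup>2) \<partial>lborel) * indicator V' x \<partial>lborel)"
      unfolding variation_def by (intro nn_integral_mono) (auto simp: indicator_def)
    also have "\<dots> = variation V W g + variation V' W g"
      unfolding variation_def by (intro nn_integral_add) measurable
    also have "\<dots> \<le> ennreal C * energy \<Omega> G + ennreal C' * energy \<Omega> G"
      by (intro add_mono C(2)[rule_format] C'(2)[rule_format] C1)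
    also have "\<dots> = ennreal (C + C') * energy \<Omega> G"
      using C(1) C'(1) by (simp add: distrib_right)
    finally show "variation (V \<union> V') W g \<le> ennreal (C + C') * energy \<Omega> G" .
  qed
qed

lemma linked_empty: "linked \<Omega> {} W"
  unfolding linked_def variation_def by (intro exI[of _ 0]) auto

lemma linked_UN:
  assumes "finite I" "W \<in> sets borel"
    and "\<And>i. i \<in> I \<Longrightarrow> V i \<in> sets borel" "\<And>i. i \<in> I \<Longrightarrow> linked \<Omega> (V i) W"
  shows "linked \<Omega> (\<Union>i\<in>I. V i) W"
  using assms
proof (induction I rule: finite_induct)
  case empty
  then show ?case by (simp add: linked_empty)
next
  case (insert i I)
  then have "linked \<Omega> (V i \<union> (\<Union>i\<in>I. V i)) W"
    by (intro linked_Un sets.finite_UN) auto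
  then show ?case by simp
qed

text \<open>Average \<open>(g x - g y)\<^sup>2 \<le> 2 (g x - g z)\<^sup>2 + 2 (g z - g y)\<^sup>2\<close> over \<open>z \<in> B\<close>. The intermediate set \<open>B\<close> has to
be of positive measure, which is where openness enters.\<close>

lemma linked_trans:
  assumes VB: "linked \<Omega> V B" and BW: "linked \<Omega> B W"
    and B: "open B" "B \<noteq> {}"
    and meas: "V \<in> sets borel" "W \<in> sets borel"
    and bd: "bounded V" "bounded B" "bounded W"
  shows "linked \<Omega> V W"
proof -
  note [measurable] = meas
  have B_meas[measurable]: "B \<in> sets borel" using B by auto
  define v b w where "v = measure lborel V" and "b = measure lborel B" and "w = measure lborel W"
  have em: "emeasure lborel V = ennreal v" "emeasure lborel B = ennreal b" "emeasure lborel W = ennreal w"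
    unfolding v_def b_def w_def
    using emeasure_bounded_finite[OF bd(1)] emeasure_bounded_finite[OF bd(2)] emeasure_bounded_finite[OF bd(3)]
    by (auto intro!: emeasure_eq_ennreal_measure)
  have nn: "0 \<le> v" "0 \<le> w" by (auto simp: v_def w_def)
  have "emeasure lborel B \<noteq> 0"
    using B open_not_negligible[of B] by (auto simp: negligible_iff_null_sets null_sets_def null_sets_completion_iff)
  then have b: "0 < b" using em(2) by (auto simp: b_def less_le)
  obtain C where C: "0 \<le> C" "\<forall>g G. C1_fun \<Omega> g G \<longrightarrow> variation V B g \<le> ennreal C * energy \<Omega> G"
    using linked_nonneg_const[OF VB] by blast
  obtain C' where C': "0 \<le> C'" "\<forall>g G. C1_fun \<Omega> g G \<longrightarrow> variation B W g \<le> ennreal C' * energy \<Omega> G"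
    using linked_nonneg_const[OF BW] by blast
  show ?thesis unfolding linked_def
  proof (intro exI allI impI)
    fix g G assume C1: "C1_fun \<Omega> g G"
    then have [measurable]: "g \<in> borel_measurable borel" by (simp add: C1_fun_def)
    let ?\<chi> = "\<lambda>A x. indicator A x :: ennreal"
    define D where "D x y = ennreal ((g x - g y)\<^sup>2)" for x y
    have D_meas[measurable]: "(\<lambda>(x, y). D x y) \<in> borel_measurable (borel \<Otimes>\<^sub>M borel)"
      unfolding D_def by measurable
    have D_le: "D x y \<le> 2 * D x z + 2 * D z y" for x y z
    proof -
      have "(g x - g y)\<^sup>2 \<le> 2 * (g x - g z)\<^sup>2 + 2 * (g z - g y)\<^sup>2"
        using zero_le_power2[of "(g x - g z) - (g z - g y)"] by (simp add: power2_eq_square algebra_simps)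
      then have "D x y \<le> ennreal (2 * (g x - g z)\<^sup>2 + 2 * (g z - g y)\<^sup>2)"
        unfolding D_def by (rule ennreal_leI)
      also have "\<dots> = 2 * D x z + 2 * D z y" unfolding D_def by (simp add: ennreal_mult)
      finally show ?thesis .
    qed
    have var: "variation S T g = (\<integral>\<^sup>+x. (\<integral>\<^sup>+y. D x y * ?\<chi> T y * ?\<chi> S x \<partial>lborel) \<partial>lborel)"
      if [measurable]: "S \<in> sets borel" "T \<in> sets borel" for S T
      unfolding variation_def D_def by (intro nn_integral_cong nn_integral_multc[symmetric]) measurable
    have "ennreal b * variation V W g =
        (\<integral>\<^sup>+x. (\<integral>\<^sup>+y. (\<integral>\<^sup>+z. D x y * ?\<chi> W y * ?\<chi> V x * ?\<chi> B z \<partial>lborel) \<partial>lborel) \<partial>lborel)"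
      by (simp add: var nn_integral_cmult_indicator em nn_integral_multc mult.commute[of "ennreal b"])
    also have "\<dots> \<le> (\<integral>\<^sup>+x. (\<integral>\<^sup>+y. (\<integral>\<^sup>+z. 2 * (D x z * ?\<chi> B z * ?\<chi> V x * ?\<chi> W y) +
        2 * (D z y * ?\<chi> W y * ?\<chi> B z * ?\<chi> V x) \<partial>lborel) \<partial>lborel) \<partial>lborel)"
      by (intro nn_integral_mono) (auto simp: indicator_def D_le)
    also have "\<dots> = 2 * (\<integral>\<^sup>+x. (\<integral>\<^sup>+y. (\<integral>\<^sup>+z. D x z * ?\<chi> B z * ?\<chi> V x * ?\<chi> W y \<partial>lborel) \<partial>lborel) \<partial>lborel) +
        2 * (\<integral>\<^sup>+x. (\<integral>\<^sup>+y. (\<integral>\<^sup>+z. D z y * ?\<chi> W y * ?\<chi> B z * ?\<chi> V x \<partial>lborel) \<partial>lborel) \<partial>lborel)"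
      by (simp add: nn_integral_add nn_integral_cmult)
    also have "(\<integral>\<^sup>+x. (\<integral>\<^sup>+y. (\<integral>\<^sup>+z. D x z * ?\<chi> B z * ?\<chi> V x * ?\<chi> W y \<partial>lborel) \<partial>lborel) \<partial>lborel) =
        ennreal w * variation V B g"
      by (simp add: var nn_integral_multc nn_integral_cmult nn_integral_cmult_indicator em mult.commute[of "ennreal w"])
    also have "(\<integral>\<^sup>+x. (\<integral>\<^sup>+y. (\<integral>\<^sup>+z. D z y * ?\<chi> W y * ?\<chi> B z * ?\<chi> V x \<partial>lborel) \<partial>lborel) \<partial>lborel) =
        (\<integral>\<^sup>+x. (\<integral>\<^sup>+y. (\<integral>\<^sup>+z. D z y * ?\<chi> W y * ?\<chi> B z \<partial>lborel) \<partial>lborel) * ?\<chi> V x \<partial>lborel)"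
      by (simp add: nn_integral_multc)
    also have "\<dots> = ennreal v * (\<integral>\<^sup>+y. (\<integral>\<^sup>+z. D z y * ?\<chi> W y * ?\<chi> B z \<partial>lborel) \<partial>lborel)"
      by (subst nn_integral_cmult_indicator) (simp_all add: em mult.commute)
    also have "(\<integral>\<^sup>+y. (\<integral>\<^sup>+z. D z y * ?\<chi> W y * ?\<chi> B z \<partial>lborel) \<partial>lborel) = variation B W g"
      unfolding var[OF B_meas meas(2)] by (intro lborel_pair.Fubini') measurable
    finally have "ennreal b * variation V W g \<le> 2 * (ennreal w * variation V B g) + 2 * (ennreal v * variation B W g)" .
    also have "\<dots> \<le> 2 * (ennreal w * (ennreal C * energy \<Omega> G)) + 2 * (ennreal v * (ennreal C' * energy \<Omega> G))"
      by (intro add_mono mult_left_mono C(2)[rule_format] C'(2)[rule_format] C1) auto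
    also have "\<dots> = ennreal (2 * w * C + 2 * v * C') * energy \<Omega> G"
      using nn C(1) C'(1) by (simp add: ennreal_mult distrib_right mult.assoc)
    finally have "ennreal (1 / b) * (ennreal b * variation V W g) \<le>
        ennreal (1 / b) * (ennreal (2 * w * C + 2 * v * C') * energy \<Omega> G)"
      by (rule mult_left_mono) simp
    moreover have "ennreal (1 / b) * (ennreal b * variation V W g) = variation V W g"
      using b by (simp add: mult.assoc[symmetric] ennreal_mult[symmetric])
    moreover have "ennreal (1 / b) * (ennreal (2 * w * C + 2 * v * C') * energy \<Omega> G) =
        ennreal (1 / b * (2 * w * C + 2 * v * C')) * energy \<Omega> G"
      using b nn C(1) C'(1) by (subst ennreal_mult) (simp_all add: mult.assoc)
    ultimately show "variation V W g \<le> ennreal (1 / b * (2 * w * C + 2 * v * C')) * energy \<Omega> G"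
      by simp
  qed
qed

section \<open>Bounded domains with boundary of class \<open>C\<^sup>1\<close>\<close>

lemma linked_ball:
  fixes \<Omega> :: "'a::euclidean_space set"
  assumes "open \<Omega>" "bounded \<Omega>" "ball a e \<subseteq> \<Omega>"
  shows "linked \<Omega> (ball a e) (ball a e)"
proof (rule linked_segments)
  show "closed_segment x y \<subseteq> \<Omega>" if "x \<in> ball a e" "y \<in> ball a e" for x y
    using closed_segment_subset[OF that convex_ball] assms(3) by blast
qed (use assms in auto)

text \<open>The points with a neighbourhood linked to a given ball form an open and closed subset of \<open>\<Omega>\<close>: any two
overlapping balls in \<open>\<Omega>\<close> are linked through their intersection.\<close>

lemma linked_interior:
  fixes \<Omega> :: "'a::euclidean_space set"
  assumes \<Omega>: "open \<Omega>" "connected \<Omega>" "bounded \<Omega>"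
    and a: "0 < e" "ball a e \<subseteq> \<Omega>" and p: "p \<in> \<Omega>"
  shows "\<exists>r>0. linked \<Omega> (ball p r) (ball a e)"
proof -
  define P where "P p \<longleftrightarrow> (\<exists>r>0. linked \<Omega> (ball p r) (ball a e))" for p
  have "P p"
  proof (rule connected_induction_simple[OF \<Omega>(2)])
    show "a \<in> \<Omega>" using a by auto
    show "p \<in> \<Omega>" by (rule p)
    show "P a" using linked_ball[OF \<Omega>(1,3) a(2)] a(1) unfolding P_def by blast
    fix q assume "q \<in> \<Omega>"
    then obtain \<rho> where \<rho>: "0 < \<rho>" "ball q \<rho> \<subseteq> \<Omega>" using \<Omega>(1) open_contains_ball by blast
    define T where "T = ball q \<rho>"
    have T: "open T" "q \<in> T" "linked \<Omega> T T" "bounded T" "T \<subseteq> \<Omega>"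
      unfolding T_def using \<rho> linked_ball[OF \<Omega>(1,3) \<rho>(2)] by auto
    have "P y" if "x \<in> T" "y \<in> T" "P x" for x y
    proof -
      obtain r where r: "0 < r" "linked \<Omega> (ball x r) (ball a e)" using \<open>P x\<close> P_def by blast
      let ?B = "ball x r \<inter> T"
      have "linked \<Omega> T (ball a e)"
      proof (rule linked_trans)
        show "linked \<Omega> T ?B" by (rule linked_mono[OF T(3)]) auto
        show "linked \<Omega> ?B (ball a e)" by (rule linked_mono[OF r(2)]) auto
        show "open ?B" "?B \<noteq> {}" using T(1) r(1) \<open>x \<in> T\<close> centre_in_ball by blast+
        show "bounded ?B" using T(4) by (simp add: bounded_Int)
      qed (use T in auto)
      moreover obtain r' where "0 < r'" "ball y r' \<subseteq> T" using T(1) \<open>y \<in> T\<close> open_contains_ball by blast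
      ultimately show "P y" unfolding P_def using linked_mono by (meson order_refl)
    qed
    then show "\<exists>T. openin (top_of_set \<Omega>) T \<and> q \<in> T \<and> (\<forall>x\<in>T. \<forall>y\<in>T. P x \<longrightarrow> P y)"
      using T(1,2,5) openin_open_eq[OF \<Omega>(1), of T] by blast
  qed
  then show ?thesis by (simp add: P_def)
qed

lemma Ck_1_lipschitz_on_cball:
  fixes g :: "'a::euclidean_space \<Rightarrow> real"
  assumes "Ck_on 1 UNIV g"
  obtains L where "0 \<le> L" "\<And>x y. x \<in> cball c r \<Longrightarrow> y \<in> cball c r \<Longrightarrow> \<bar>g x - g y\<bar> \<le> L * norm (x - y)"
proof -
  obtain G where G: "\<And>z. (g has_derivative (\<lambda>h. G z \<bullet> h)) (at z)"
      "\<And>b. b \<in> Basis \<Longrightarrow> continuous_on UNIV (\<lambda>z. G z \<bullet> b)"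
    using assms[unfolded One_nat_def Ck_on.simps] by auto
  have "continuous_on UNIV G" using G(2) by (subst continuous_on_componentwise) auto
  then have "continuous_on (cball c r) G" by (rule continuous_on_subset) simp
  then have "bounded (G ` cball c r)"
    by (intro compact_imp_bounded compact_continuous_image) auto
  then obtain L where L: "0 < L" "\<And>z. z \<in> cball c r \<Longrightarrow> norm (G z) \<le> L"
    by (auto simp: bounded_pos)
  show thesis
  proof (rule that[of L])
    fix x y assume xy: "x \<in> cball c r" "y \<in> cball c r"
    have "norm (g x - g y) \<le> L * norm (x - y)"
    proof (rule differentiable_bound[OF convex_cball _ _ xy])
      show "(g has_derivative (\<lambda>h. G z \<bullet> h)) (at z within cball c r)" for z
        by (rule has_derivative_at_withinI[OF G(1)])
      show "onorm (\<lambda>h. G z \<bullet> h) \<le> L" if "z \<in> cball c r" for z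
        by (rule onorm_le)
           (use Cauchy_Schwarz_ineq2 L(2)[OF that] in
            \<open>force intro: order_trans[OF _ mult_right_mono] simp: real_norm_def\<close>)
    qed
    then show "\<bar>g x - g y\<bar> \<le> L * norm (x - y)" by simp
  qed (use L in simp)
qed

text \<open>A boundary point has a one-sided neighbourhood from which a whole ball in \<open>\<Omega>\<close> is visible. In the local
coordinates \<open>\<Omega>\<close> is the epigraph of a function \<open>g\<close> with Lipschitz constant \<open>L\<close>, so a segment that starts in
\<open>\<Omega>\<close> and climbs with slope at least \<open>L\<close> with respect to the axis \<open>\<nu>\<close> stays in the epigraph. It suffices to take a small
ball around a point at height \<open>t\<close> above \<open>p\<close>.\<close>

lemma C1_boundary_segments:
  fixes \<Omega> :: "'a::euclidean_space set"
  assumes "C1_boundary \<Omega>" "p \<in> frontier \<Omega>"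
  shows "\<exists>s>0. \<exists>B. open B \<and> B \<noteq> {} \<and> B \<subseteq> \<Omega> \<and>
    (\<forall>x\<in>\<Omega> \<inter> ball p s. \<forall>y\<in>B. closed_segment x y \<subseteq> \<Omega>)"
proof -
  obtain r \<nu> g where r: "0 < r" and \<nu>: "norm \<nu> = 1" and g: "Ck_on 1 UNIV g"
    and epi: "\<Omega> \<inter> ball p r = {x \<in> ball p r. g (x - (x \<bullet> \<nu>) *\<^sub>R \<nu>) < x \<bullet> \<nu>}"
    using assms unfolding C1_boundary_def by blast
  define \<pi> where "\<pi> x = x - (x \<bullet> \<nu>) *\<^sub>R \<nu>" for x
  have \<nu>2: "\<nu> \<bullet> \<nu> = 1" using \<nu> by (simp add: norm_eq_1)
  have \<pi>_diff: "\<pi> x - \<pi> y = \<pi> (x - y)" for x y by (simp add: \<pi>_def algebra_simps)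
  have \<pi>_norm: "norm (\<pi> x) \<le> norm x" for x
  proof -
    have "(norm (\<pi> x))\<^sup>2 = (norm x)\<^sup>2 - (x \<bullet> \<nu>)\<^sup>2"
      unfolding power2_norm_eq_inner \<pi>_def
      by (simp add: inner_diff \<nu>2 inner_commute[of \<nu> x] power2_eq_square)
    then have "(norm (\<pi> x))\<^sup>2 \<le> (norm x)\<^sup>2" by simp
    then show ?thesis by (rule power2_le_imp_le) simp
  qed
  have \<pi>_ball: "\<pi> x \<in> cball (\<pi> p) r" if "x \<in> ball p r" for x
    using \<pi>_norm[of "p - x"] that by (simp add: dist_norm \<pi>_diff)
  obtain L where L: "0 \<le> L"
      "\<And>x y. x \<in> cball (\<pi> p) r \<Longrightarrow> y \<in> cball (\<pi> p) r \<Longrightarrow> \<bar>g x - g y\<bar> \<le> L * norm (x - y)"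
    using Ck_1_lipschitz_on_cball[OF g, of "\<pi> p" r] by blast
  \<comment> \<open>Segments between the \<open>s\<close>-balls around \<open>p\<close> and \<open>p + t \<nu>\<close> rise by at least \<open>t - 2 s\<close> and move
    sideways by at most \<open>2 s\<close>, so \<open>t - 2 s = 2 s L\<close> gives slope \<open>L\<close>; and \<open>t + s < r\<close> keeps them in the chart.\<close>
  define s where "s = r / (2 * L + 4)"
  define t where "t = 2 * s * (L + 1)"
  define B where "B = ball (p + t *\<^sub>R \<nu>) s"
  have s: "0 < s" using r L(1) by (simp add: s_def)
  have t: "0 \<le> t" using s L(1) by (simp add: t_def)
  have "(2 * L + 4) * s = r" using L(1) by (simp add: s_def)
  then have ts: "t + s < r" using s by (simp add: t_def algebra_simps)
  have B_sub: "B \<subseteq> ball p r"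
  proof
    fix y assume "y \<in> B"
    then have "dist (p + t *\<^sub>R \<nu>) y < s" by (simp add: B_def)
    moreover have "dist p (p + t *\<^sub>R \<nu>) = t" using t \<nu> by (simp add: dist_norm)
    ultimately show "y \<in> ball p r" using ts dist_triangle[of p y "p + t *\<^sub>R \<nu>"] by simp
  qed
  have seg: "closed_segment x y \<subseteq> \<Omega>" if x: "x \<in> \<Omega>" "x \<in> ball p s" and y: "y \<in> B" for x y
  proof
    fix z assume "z \<in> closed_segment x y"
    then obtain \<theta> where \<theta>: "0 \<le> \<theta>" "\<theta> \<le> 1" and z: "z = (1 - \<theta>) *\<^sub>R x + \<theta> *\<^sub>R y"
      by (auto simp: closed_segment_def)
    have xr: "x \<in> ball p r" using x(2) ts t by auto
    have yr: "y \<in> ball p r" using y B_sub by blast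
    have zr: "z \<in> ball p r"
      using convexD[OF convex_ball xr yr, of "1 - \<theta>" \<theta>] \<theta> by (simp add: z)
    define w where "w = (y - (p + t *\<^sub>R \<nu>)) - (x - p)"
    have "norm w \<le> norm (y - (p + t *\<^sub>R \<nu>)) + norm (x - p)" unfolding w_def by (rule norm_triangle_ineq4)
    also have "\<dots> \<le> 2 * s" using x(2) y by (simp add: B_def dist_norm norm_minus_commute)
    finally have w: "norm w \<le> 2 * s" .
    have yx: "y - x = w + t *\<^sub>R \<nu>" by (simp add: w_def)
    have "\<bar>w \<bullet> \<nu>\<bar> \<le> 2 * s" using Cauchy_Schwarz_ineq2[of w \<nu>] w \<nu> by simp
    then have up: "t - 2 * s \<le> (y - x) \<bullet> \<nu>" by (simp add: yx inner_add_left \<nu>2)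
    have "\<pi> (y - x) = \<pi> w" by (simp add: yx \<pi>_def inner_add_left \<nu>2 algebra_simps)
    then have side: "norm (\<pi> (y - x)) \<le> 2 * s" using \<pi>_norm[of w] w by simp
    have zx: "z - x = \<theta> *\<^sub>R (y - x)" by (simp add: z algebra_simps)
    have "\<pi> z - \<pi> x = \<theta> *\<^sub>R \<pi> (y - x)" unfolding \<pi>_diff zx by (simp add: \<pi>_def algebra_simps)
    then have "norm (\<pi> z - \<pi> x) \<le> \<theta> * (2 * s)" using side \<theta>(1) by (simp add: mult_left_mono)
    then have "L * norm (\<pi> z - \<pi> x) \<le> L * (\<theta> * (2 * s))" using L(1) by (rule mult_left_mono)
    then have "g (\<pi> z) - g (\<pi> x) \<le> L * (\<theta> * (2 * s))"
      using L(2)[OF \<pi>_ball[OF zr] \<pi>_ball[OF xr]] by linarith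
    also have "\<dots> = \<theta> * (t - 2 * s)" by (simp add: t_def algebra_simps)
    also have "\<dots> \<le> \<theta> * ((y - x) \<bullet> \<nu>)" by (rule mult_left_mono[OF up \<theta>(1)])
    also have "\<dots> = z \<bullet> \<nu> - x \<bullet> \<nu>" by (metis zx inner_diff_left inner_scaleR_left)
    finally have "g (\<pi> z) - g (\<pi> x) \<le> z \<bullet> \<nu> - x \<bullet> \<nu>" .
    moreover have "x \<in> {x \<in> ball p r. g (x - (x \<bullet> \<nu>) *\<^sub>R \<nu>) < x \<bullet> \<nu>}"
      using x(1) xr unfolding epi[symmetric] by simp
    then have "g (\<pi> x) < x \<bullet> \<nu>" by (simp add: \<pi>_def)
    ultimately have "z \<in> {x \<in> ball p r. g (x - (x \<bullet> \<nu>) *\<^sub>R \<nu>) < x \<bullet> \<nu>}"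
      using zr by (simp add: \<pi>_def)
    then show "z \<in> \<Omega>" unfolding epi[symmetric] by simp
  qed
  have "B \<subseteq> \<Omega>"
  proof -
    have "p \<in> closure \<Omega>" using assms(2) by (simp add: frontier_def)
    then obtain x where "x \<in> \<Omega>" "x \<in> ball p s"
      using s by (auto simp: closure_approachable dist_commute)
    then have "y \<in> \<Omega>" if "y \<in> B" for y using seg[of x y] that ends_in_segment(2)[of y x] by blast
    then show ?thesis by blast
  qed
  then show ?thesis
    using s seg by (intro exI[of _ s] conjI exI[of _ B] ballI) (auto simp: B_def)
qed

text \<open>Near every point of the closure \<open>\<Omega>\<close> is linked to one fixed ball: inside by connectedness, at the boundary
through a visible ball. Finitely many such neighbourhoods cover \<open>\<Omega>\<close>.\<close>

lemma linked_C1_domain: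
  fixes \<Omega> :: "'a::euclidean_space set"
  assumes "bounded_C1_domain \<Omega>"
  shows "linked \<Omega> \<Omega> \<Omega>"
proof -
  have \<Omega>: "open \<Omega>" "connected \<Omega>" "bounded \<Omega>" "\<Omega> \<noteq> {}" "C1_boundary \<Omega>"
    using assms by (auto simp: bounded_C1_domain_def)
  obtain a e where a: "0 < e" "ball a e \<subseteq> \<Omega>" using \<Omega>(1,4) open_contains_ball by blast
  have bd: "bounded S" if "S \<subseteq> \<Omega>" for S using that \<Omega>(3) bounded_subset by blast
  have local: "\<exists>r>0. linked \<Omega> (\<Omega> \<inter> ball p r) (ball a e)" if "p \<in> closure \<Omega>" for p
  proof (cases "p \<in> \<Omega>")
    case True
    then obtain r where "0 < r" "linked \<Omega> (ball p r) (ball a e)"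
      using linked_interior[OF \<Omega>(1-3) a] by blast
    moreover from this(2) have "linked \<Omega> (\<Omega> \<inter> ball p r) (ball a e)" by (rule linked_mono) auto
    ultimately show ?thesis by blast
  next
    case False
    then have "p \<in> frontier \<Omega>" using that \<Omega>(1) by (simp add: frontier_def interior_open)
    from C1_boundary_segments[OF \<Omega>(5) this]
    obtain s B where s: "0 < s" and B: "open B" "B \<noteq> {}" "B \<subseteq> \<Omega>"
      and seg: "\<And>x y. x \<in> \<Omega> \<inter> ball p s \<Longrightarrow> y \<in> B \<Longrightarrow> closed_segment x y \<subseteq> \<Omega>"
      by blast
    obtain b where b: "b \<in> B" using B by blast
    then obtain \<rho> where \<rho>: "0 < \<rho>" "linked \<Omega> (ball b \<rho>) (ball a e)"
      using linked_interior[OF \<Omega>(1-3) a] B(3) by blast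
    let ?B = "ball b \<rho> \<inter> B"
    have "linked \<Omega> (\<Omega> \<inter> ball p s) (ball a e)"
    proof (rule linked_trans)
      show "linked \<Omega> (\<Omega> \<inter> ball p s) ?B"
        using \<Omega> B(1) seg by (intro linked_segments) auto
      show "linked \<Omega> ?B (ball a e)" by (rule linked_mono[OF \<rho>(2)]) auto
      show "open ?B" "?B \<noteq> {}" using B(1) b \<rho>(1) centre_in_ball by blast+
      show "bounded (\<Omega> \<inter> ball p s)" "bounded ?B" "bounded (ball a e)" by (intro bd; use a B in blast)+
    qed (use \<Omega> in auto)
    then show ?thesis using s by blast
  qed
  then obtain r where r: "\<And>p. p \<in> closure \<Omega> \<Longrightarrow> 0 < r p \<and> linked \<Omega> (\<Omega> \<inter> ball p (r p)) (ball a e)"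
    by metis
  have "compact (closure \<Omega>)" using \<Omega>(3) by (simp add: compact_closure)
  then obtain F where F: "F \<subseteq> closure \<Omega>" "finite F" "closure \<Omega> \<subseteq> (\<Union>p\<in>F. ball p (r p))"
  proof (rule compactE_image[of _ "closure \<Omega>" "\<lambda>p. ball p (r p)"])
    show "closure \<Omega> \<subseteq> (\<Union>p\<in>closure \<Omega>. ball p (r p))" using r centre_in_ball by blast
  qed auto
  have "linked \<Omega> (\<Union>p\<in>F. \<Omega> \<inter> ball p (r p)) (ball a e)"
    using F r \<Omega>(1) by (intro linked_UN) auto
  moreover have "(\<Union>p\<in>F. \<Omega> \<inter> ball p (r p)) = \<Omega>" using F(3) closure_subset[of \<Omega>] by blast
  ultimately have *: "linked \<Omega> \<Omega> (ball a e)" by simp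
  show ?thesis
  proof (rule linked_trans[OF *])
    show "linked \<Omega> (ball a e) \<Omega>" using linked_sym[OF *] \<Omega>(1) by simp
  qed (use a \<Omega> in auto)
qed

section \<open>Truncation and pointwise comparison\<close>

text \<open>For \<open>K > 0\<close> the function \<open>trunc K\<close> is the identity up to \<open>0\<close>, the parabola \<open>s - s\<^sup>2 / (2 K)\<close> between \<open>0\<close> and \<open>K\<close>, and the
constant \<open>K / 2\<close> from there on. Written with squares of positive parts it is visibly of class \<open>C\<^sup>1\<close>.\<close>

definition trunc :: "real \<Rightarrow> real \<Rightarrow> real" where
  "trunc K s = s - (max 0 s)\<^sup>2 / (2 * K) + (max 0 (s - K))\<^sup>2 / (2 * K)"

definition trunc' :: "real \<Rightarrow> real \<Rightarrow> real" where
  "trunc' K s = 1 - max 0 s / K + max 0 (s - K) / K"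

lemma DERIV_pos_part_squared:
  "((\<lambda>y::real. (max 0 y)\<^sup>2) has_real_derivative 2 * max 0 y) (at y)"
proof (cases y "0::real" rule: linorder_cases)
  case less
  have "((\<lambda>y. 0::real) has_real_derivative 2 * max 0 y) (at y)" using less by simp
  then show ?thesis
    by (rule has_field_derivative_transform_within_open[of _ _ _ "{..<0}"]) (use less in auto)
next
  case greater
  have "((\<lambda>y. y\<^sup>2) has_real_derivative 2 * max 0 y) (at y)"
    using greater by (auto intro!: derivative_eq_intros)
  then show ?thesis
    by (rule has_field_derivative_transform_within_open[of _ _ _ "{0<..}"]) (use greater in auto)
next
  case equal
  have "((\<lambda>h::real. (max 0 h)\<^sup>2 / h) \<longlongrightarrow> 0) (at 0)"
  proof (rule tendsto_rabs_zero_cancel, rule tendsto_sandwich[of "\<lambda>_. 0" _ _ "\<lambda>h. \<bar>h\<bar>"])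
    show "\<forall>\<^sub>F h::real in at 0. \<bar>(max 0 h)\<^sup>2 / h\<bar> \<le> \<bar>h\<bar>"
      by (intro always_eventually) (auto simp: max_def power2_eq_square)
    show "((\<lambda>h::real. \<bar>h\<bar>) \<longlongrightarrow> 0) (at 0)" by (intro tendsto_eq_intros) auto
  qed auto
  then show ?thesis using equal by (simp add: DERIV_def)
qed

lemma DERIV_trunc:
  "(trunc K has_real_derivative trunc' K s) (at s)"
proof -
  have "((\<lambda>s. s - K) has_real_derivative 1) (at s)" by (auto intro!: derivative_eq_intros)
  from DERIV_chain2[OF DERIV_pos_part_squared this]
  have "((\<lambda>s. (max 0 (s - K))\<^sup>2) has_real_derivative 2 * max 0 (s - K)) (at s)" by simp
  note DERIV_add[OF DERIV_diff[OF DERIV_ident DERIV_cdivide[OF DERIV_pos_part_squared, where c = "2 * K"]]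
      DERIV_cdivide[OF this, where c = "2 * K"]]
  then show ?thesis
    unfolding trunc_def[abs_def] trunc'_def by simp
qed

lemma continuous_on_trunc': "continuous_on S (trunc' K)"
  unfolding trunc'_def[abs_def] divide_inverse by (intro continuous_intros)

lemma trunc_nonpos: "0 < K \<Longrightarrow> s \<le> 0 \<Longrightarrow> trunc K s = s"
  by (simp add: trunc_def)

lemma trunc_mid:
  assumes "0 < K" "0 \<le> s" "s \<le> K"
  shows "s / 2 \<le> trunc K s" "trunc K s \<le> s"
proof -
  have "s * s \<le> s * K" using assms by (intro mult_left_mono)
  then show "s / 2 \<le> trunc K s" using assms by (simp add: trunc_def field_simps power2_eq_square)
  show "trunc K s \<le> s" using assms by (simp add: trunc_def)
qed

lemma trunc_const: "0 < K \<Longrightarrow> K \<le> s \<Longrightarrow> trunc K s = K / 2"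
  by (simp add: trunc_def field_simps power2_eq_square)

lemma trunc'_const: "0 < K \<Longrightarrow> K \<le> s \<Longrightarrow> trunc' K s = 0"
  by (simp add: trunc'_def field_simps)

lemma trunc'_range: "0 < K \<Longrightarrow> 0 \<le> trunc' K s \<and> trunc' K s \<le> 1"
  by (auto simp: trunc'_def field_simps max_def)

lemma trunc_contraction:
  assumes "0 < K"
  shows "\<bar>trunc K s - trunc K t\<bar> \<le> \<bar>s - t\<bar>"
proof -
  have "norm (trunc K s - trunc K t) \<le> 1 * norm (s - t)"
  proof (rule field_differentiable_bound[where S = UNIV and f' = "trunc' K"])
    show "(trunc K has_field_derivative trunc' K z) (at z within UNIV)" for z
      using DERIV_trunc by simp
    show "norm (trunc' K z) \<le> 1" for z using trunc'_range[OF assms, of z] by simp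
  qed auto
  then show ?thesis by simp
qed

text \<open>The pointwise information about the density value \<open>s\<close>, the equilibrium value \<open>\<mu>\<close>, the truncated value \<open>g\<close> of
\<open>f\<close> and the energy value \<open>e\<close>. Below \<open>\<mu>\<close> the numbers \<open>g\<close> and \<open>\<mu> - s\<close> are equivalent. Above \<open>\<mu>\<close> neither \<open>-g\<close> nor
\<open>s - \<mu>\<close> need be bounded, and their growth rates are unrelated; there \<open>-g\<close> bounds \<open>s - \<mu>\<close> only with the weight
\<open>1 + s\<close>, and \<open>s - \<mu>\<close> bounds \<open>-g\<close> only up to \<open>1\<close>.\<close>

definition comparable :: "real \<Rightarrow> real \<Rightarrow> real \<Rightarrow> real \<Rightarrow> real \<Rightarrow> bool" where
  "comparable C s \<mu> g e \<longleftrightarrow>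
     (s \<le> \<mu> \<longrightarrow> \<mu> - s \<le> C * g \<and> g \<le> C * (\<mu> - s)) \<and>
     (\<mu> < s \<longrightarrow> g < 0 \<and> min (- g) 1 \<le> C * (s - \<mu>) \<and> s - \<mu> \<le> C * ((1 + s) * (- g))) \<and>
     e \<le> C * ((1 + s) * g\<^sup>2) \<and> \<mu> \<le> C"

text \<open>If \<open>g\<close> were equal to \<open>b \<ge> 0\<close> everywhere, then \<open>s \<le> \<mu>\<close> everywhere, with a deficit proportional to \<open>b\<close>; if \<open>b < 0\<close>,
then \<open>s > \<mu>\<close> with a definite excess. So \<open>|b|\<close> is bounded by a multiple of \<open>s - \<mu>\<close> with the appropriate sign, plus
an error in \<open>|g - b|\<close>. The multiplier \<open>k\<close> may depend on \<open>b\<close>, since its term disappears by conservation of mass,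
while the factor \<open>1 + C\<^sup>2\<close> may not.\<close>

lemma comparable_level:
  assumes C: "1 \<le> C"
  obtains k where "\<And>s \<mu> g e. 0 \<le> s \<Longrightarrow> comparable C s \<mu> g e \<Longrightarrow>
    \<bar>b\<bar> \<le> (1 + C\<^sup>2) * ((1 + s) * \<bar>g - b\<bar>) + k * (s - \<mu>)"
proof (cases "0 \<le> b")
  case True
  have "\<bar>b\<bar> \<le> (1 + C\<^sup>2) * ((1 + s) * \<bar>g - b\<bar>) + (- C) * (s - \<mu>)"
    if s: "0 \<le> s" and c: "comparable C s \<mu> g e" for s \<mu> g e
  proof -
    have a: "\<bar>g - b\<bar> \<le> (1 + s) * \<bar>g - b\<bar>" using s by (simp add: distrib_right)
    have e: "(1 + C\<^sup>2) * ((1 + s) * \<bar>g - b\<bar>) = (1 + s) * \<bar>g - b\<bar> + C * (C * ((1 + s) * \<bar>g - b\<bar>))"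
      by (simp add: algebra_simps power2_eq_square)
    have n: "0 \<le> C * (C * ((1 + s) * \<bar>g - b\<bar>))" using C s by simp
    show ?thesis
    proof (cases "s \<le> \<mu>")
      case True
      then have "g \<le> C * (\<mu> - s)" using c by (simp add: comparable_def)
      moreover have "(- C) * (s - \<mu>) = C * (\<mu> - s)" by (simp add: algebra_simps)
      moreover have "\<bar>b\<bar> \<le> \<bar>g - b\<bar> + g" using \<open>0 \<le> b\<close> by simp
      ultimately show ?thesis using a n e by linarith
    next
      case False
      then have g: "g < 0" "s - \<mu> \<le> C * ((1 + s) * (- g))" using c by (auto simp: comparable_def)
      have "C * ((1 + s) * (- g)) \<le> C * ((1 + s) * \<bar>g - b\<bar>)"
        using g(1) \<open>0 \<le> b\<close> C s by (intro mult_left_mono) auto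
      then have "C * (s - \<mu>) \<le> C * (C * ((1 + s) * \<bar>g - b\<bar>))"
        using g(2) C by (intro mult_left_mono) auto
      moreover have "\<bar>b\<bar> \<le> \<bar>g - b\<bar>" using g(1) \<open>0 \<le> b\<close> by simp
      ultimately show ?thesis using a e by (simp add: algebra_simps)
    qed
  qed
  then show ?thesis by (rule that)
next
  case False
  \<comment> \<open>The excess \<open>s - \<mu>\<close> controls \<open>min (-g) 1\<close> only; the factor \<open>h\<close> turns this into control of \<open>min (-g) |b|\<close>.\<close>
  define h where "h = max 1 \<bar>b\<bar>"
  have h: "1 \<le> h" "\<bar>b\<bar> \<le> h" by (auto simp: h_def)
  have "\<bar>b\<bar> \<le> (1 + C\<^sup>2) * ((1 + s) * \<bar>g - b\<bar>) + (C * h) * (s - \<mu>)"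
    if s: "0 \<le> s" and c: "comparable C s \<mu> g e" for s \<mu> g e
  proof -
    have a: "\<bar>g - b\<bar> \<le> (1 + s) * \<bar>g - b\<bar>" using s by (simp add: distrib_right)
    then have a': "(1 + C\<^sup>2) * \<bar>g - b\<bar> \<le> (1 + C\<^sup>2) * ((1 + s) * \<bar>g - b\<bar>)" by (intro mult_left_mono) auto
    have e: "(1 + C\<^sup>2) * \<bar>g - b\<bar> = \<bar>g - b\<bar> + C * (C * \<bar>g - b\<bar>)"
      by (simp add: algebra_simps power2_eq_square)
    have n: "0 \<le> C * (C * \<bar>g - b\<bar>)" using C by simp
    show ?thesis
    proof (cases "s \<le> \<mu>")
      case True
      then have g: "\<mu> - s \<le> C * g" "\<mu> \<le> C" using c by (auto simp: comparable_def)
      have "0 \<le> C * g" using g(1) True by linarith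
      then have g0: "0 \<le> g" using C by (simp add: zero_le_mult_iff)
      have gb: "\<bar>b\<bar> \<le> \<bar>g - b\<bar>" "g \<le> \<bar>g - b\<bar>" using g0 False by auto
      have "h * (\<mu> - s) \<le> C * \<bar>g - b\<bar>"
      proof (cases "\<bar>b\<bar> \<le> 1")
        case True
        then have "h = 1" by (simp add: h_def)
        moreover have "C * g \<le> C * \<bar>g - b\<bar>" using gb(2) C by (intro mult_left_mono) auto
        ultimately show ?thesis using g(1) by simp
      next
        case False
        then have "h * (\<mu> - s) = \<bar>b\<bar> * (\<mu> - s)" by (simp add: h_def)
        also have "\<dots> \<le> \<bar>g - b\<bar> * C" using gb(1) g(2) s \<open>s \<le> \<mu>\<close> by (intro mult_mono) auto
        finally show ?thesis by (simp add: mult.commute)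
      qed
      then have "C * (h * (\<mu> - s)) \<le> C * (C * \<bar>g - b\<bar>)" using C by (intro mult_left_mono) auto
      moreover have "(C * h) * (s - \<mu>) = - (C * (h * (\<mu> - s)))" by (simp add: algebra_simps)
      ultimately show ?thesis using a' e gb(1) by linarith
    next
      case False
      then have g: "g < 0" "min (- g) 1 \<le> C * (s - \<mu>)" using c by (auto simp: comparable_def)
      have "min (- g) \<bar>b\<bar> \<le> h * min (- g) 1"
      proof -
        have "- g \<le> h * (- g)" using h(1) g(1) by simp
        then show ?thesis using h by (auto simp: min_def)
      qed
      also have "\<dots> \<le> h * (C * (s - \<mu>))" using g(2) h(1) by (intro mult_left_mono) auto
      finally have "min (- g) \<bar>b\<bar> \<le> (C * h) * (s - \<mu>)" by (simp add: mult_ac)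
      moreover have "\<bar>b\<bar> \<le> \<bar>g - b\<bar> + min (- g) \<bar>b\<bar>" using g(1) by (auto simp: min_def)
      ultimately show ?thesis using a' e n by linarith
    qed
  qed
  then show ?thesis by (rule that)
qed

section \<open>The free energy and the truncated first variation\<close>

text \<open>The properties of \<open>E\<close>, \<open>f\<close> and \<open>m\<close> on a bounded open set. Both a domain and the open unit cube, as the
interior of a cell of the torus, are instances.\<close>

locale free_energy =
  fixes \<Omega> :: "'a::euclidean_space set"
    and E f :: "'a \<Rightarrow> real \<Rightarrow> real" and m :: "'a \<Rightarrow> real"
  assumes open_dom: "open \<Omega>" and bounded_dom: "bounded \<Omega>" and nonempty_dom: "\<Omega> \<noteq> {}"
    and E_cont: "continuous_on (closure \<Omega> \<times> {0..}) (\<lambda>(x, u). E x u)"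
    and f_C1: "Ck_on 1 (closure \<Omega> \<times> {0<..}) (\<lambda>(x, u). f x u)"
    and m_cont: "continuous_on (closure \<Omega>) m"
    and E_nonneg: "\<And>x u. x \<in> closure \<Omega> \<Longrightarrow> 0 \<le> u \<Longrightarrow> 0 \<le> E x u"
    and m_pos: "\<And>x. x \<in> closure \<Omega> \<Longrightarrow> 0 < m x"
    and E_m: "\<And>x. x \<in> \<Omega> \<Longrightarrow> E x (m x) = 0"
    and E_deriv: "\<And>x u. x \<in> \<Omega> \<Longrightarrow> 0 < u \<Longrightarrow> (E x has_real_derivative - f x u) (at u)"
    and f_deriv_neg: "\<And>x u. x \<in> closure \<Omega> \<Longrightarrow> 0 < u \<Longrightarrow> deriv (f x) u < 0"
begin

lemma compact_closure_dom: "compact (closure \<Omega>)"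
  using bounded_dom by (simp add: compact_closure)

lemma closure_dom_nonempty: "closure \<Omega> \<noteq> {}"
  using nonempty_dom by simp

lemma in_closure: "x \<in> \<Omega> \<Longrightarrow> x \<in> closure \<Omega>"
  using closure_subset by blast

definition joint_gradient :: "('a \<times> real \<Rightarrow> 'a \<times> real) \<Rightarrow> bool" where
  "joint_gradient F \<longleftrightarrow> continuous_on (closure \<Omega> \<times> {0<..}) F \<and>
     (\<forall>z\<in>closure \<Omega> \<times> {0<..}.
       ((\<lambda>(x, u). f x u) has_derivative (\<lambda>h. F z \<bullet> h)) (at z within closure \<Omega> \<times> {0<..}))"

lemma joint_gradient_exists: "\<exists>F. joint_gradient F"
proof -
  from f_C1[unfolded One_nat_def Ck_on.simps] obtain F where
    F: "\<forall>z\<in>closure \<Omega> \<times> {0<..}.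
      ((\<lambda>(x, u). f x u) has_derivative (\<lambda>h. F z \<bullet> h)) (at z within closure \<Omega> \<times> {0<..})"
    "\<forall>b\<in>Basis. continuous_on (closure \<Omega> \<times> {0<..}) (\<lambda>z. F z \<bullet> b)"
    by blast
  have "continuous_on (closure \<Omega> \<times> {0<..}) F"
    using F(2) by (subst continuous_on_componentwise) blast
  then show ?thesis using F(1) unfolding joint_gradient_def by blast
qed

lemma f_joint_cont: "continuous_on (closure \<Omega> \<times> {0<..}) (\<lambda>(x, u). f x u)"
proof -
  obtain F where F: "joint_gradient F" using joint_gradient_exists by blast
  show ?thesis
    by (rule has_derivative_continuous_on[where f' = "\<lambda>z h. F z \<bullet> h"]) (use F in \<open>unfold joint_gradient_def, blast\<close>)
qed

lemma f_partial:
  assumes F: "joint_gradient F" and x: "x \<in> closure \<Omega>" and u: "0 < u"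
  shows "(f x has_real_derivative snd (F (x, u))) (at u)"
proof -
  have A: "((\<lambda>u. (x, u)) has_derivative (\<lambda>h. (0, h))) (at u within {0<..})"
    by (auto intro!: derivative_eq_intros)
  have B: "((\<lambda>(x, u). f x u) has_derivative (\<lambda>h. F (x, u) \<bullet> h))
      (at (x, u) within (\<lambda>u. (x, u)) ` {0<..})"
    by (rule has_derivative_subset[where s = "closure \<Omega> \<times> {0<..}"])
       (use F x u in \<open>auto simp: joint_gradient_def\<close>)
  have "((\<lambda>u. f x u) has_derivative (\<lambda>h. snd (F (x, u)) * h)) (at u within {0<..})"
    using has_derivative_in_compose[OF A B] by (simp add: inner_prod_def)
  then show ?thesis
    using u by (simp add: has_field_derivative_def at_within_open[of _ "{0<..}"])
qed

lemma f_antimono: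
  assumes "x \<in> closure \<Omega>" "0 < s" "s \<le> t"
  shows "f x t \<le> f x s"
proof -
  obtain F where F: "joint_gradient F" using joint_gradient_exists by blast
  have "\<exists>y. (f x has_real_derivative y) (at u) \<and> y \<le> 0" if "s \<le> u" for u
    using f_partial[OF F assms(1), of u] f_deriv_neg[OF assms(1), of u] assms(2) that
    by (metis DERIV_imp_deriv less_eq_real_def less_le_trans)
  then show ?thesis using DERIV_nonpos_imp_nonincreasing[OF assms(3), of "f x"] by blast
qed

text \<open>In \<open>\<Omega>\<close> this is the vanishing of the derivative of \<open>E x\<close> at its minimum; it extends to the closure by
continuity.\<close>

lemma f_m_zero:
  assumes "x \<in> closure \<Omega>"
  shows "f x (m x) = 0"
proof (rule continuous_constant_on_closure[where S = \<Omega> and f = "\<lambda>x. f x (m x)"])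
  show "continuous_on (closure \<Omega>) (\<lambda>x. f x (m x))"
  proof -
    have "continuous_on (closure \<Omega>) (\<lambda>x. (x, m x))" by (intro continuous_intros m_cont)
    from continuous_on_compose2[OF f_joint_cont this] show ?thesis using m_pos by auto
  qed
  show "f x (m x) = 0" if x: "x \<in> \<Omega>" for x
  proof -
    have m: "0 < m x" using x by (intro m_pos in_closure)
    have "- f x (m x) = 0"
    proof (rule DERIV_local_min[OF E_deriv[OF x m] m])
      show "\<forall>y. \<bar>m x - y\<bar> < m x \<longrightarrow> E x (m x) \<le> E x y"
        using E_nonneg[OF in_closure[OF x]] E_m[OF x] by auto
    qed
    then show ?thesis by simp
  qed
qed (use assms in auto)

text \<open>On the compact set of all \<open>(x, s)\<close> with \<open>x\<close> in the closure and \<open>m x / 2 \<le> s \<le> 2 m x\<close> the derivative \<open>f\<^sub>u\<close> is bounded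
and bounded away from \<open>0\<close>.\<close>

lemma f_near_m:
  "\<exists>l L. 0 < l \<and>
    (\<forall>x\<in>closure \<Omega>. \<forall>s. m x / 2 \<le> s \<and> s \<le> m x \<longrightarrow> l * (m x - s) \<le> f x s \<and> f x s \<le> L * (m x - s)) \<and>
    (\<forall>x\<in>closure \<Omega>. \<forall>s. m x \<le> s \<and> s \<le> 2 * m x \<longrightarrow> l * (s - m x) \<le> - f x s \<and> - f x s \<le> L * (s - m x))"
proof -
  obtain F where F: "joint_gradient F" using joint_gradient_exists by blast
  then have F_cont: "continuous_on (closure \<Omega> \<times> {0<..}) F" by (simp add: joint_gradient_def)
  define Z where "Z = (\<lambda>(x, t). (x, t * m x)) ` (closure \<Omega> \<times> {1/2..2::real})"
  have Z_sub: "Z \<subseteq> closure \<Omega> \<times> {0<..}" using m_pos by (auto simp: Z_def)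
  have "continuous_on (closure \<Omega> \<times> {1/2..2::real}) (\<lambda>p. m (fst p))"
    by (rule continuous_on_compose2[OF m_cont continuous_on_fst[OF continuous_on_id]]) auto
  then have "continuous_on (closure \<Omega> \<times> {1/2..2}) (\<lambda>(x, t). (x, t * m x))"
    unfolding case_prod_beta by (intro continuous_intros)
  then have Z_comp: "compact Z" unfolding Z_def
    by (intro compact_continuous_image compact_Times compact_closure_dom) auto
  have Z_ne: "Z \<noteq> {}" using closure_dom_nonempty by (auto simp: Z_def)
  have Z_in: "(x, s) \<in> Z" if "x \<in> closure \<Omega>" "m x / 2 \<le> s" "s \<le> 2 * m x" for x s
    unfolding Z_def using that m_pos[OF that(1)]
    by (intro image_eqI[of _ _ "(x, s / m x)"]) (auto simp: field_simps)
  have cont: "continuous_on Z (\<lambda>z. snd (F z))"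
    by (intro continuous_on_snd continuous_on_subset[OF F_cont Z_sub])
  obtain z0 where z0: "z0 \<in> Z" "\<forall>z\<in>Z. snd (F z) \<le> snd (F z0)"
    using continuous_attains_sup[OF Z_comp Z_ne cont] by blast
  obtain z1 where z1: "z1 \<in> Z" "\<forall>z\<in>Z. snd (F z1) \<le> snd (F z)"
    using continuous_attains_inf[OF Z_comp Z_ne cont] by blast
  define l L where "l = - snd (F z0)" and "L = - snd (F z1)"
  have "z0 \<in> closure \<Omega> \<times> {0<..}" using z0(1) Z_sub by blast
  then obtain x0 u0 where "z0 = (x0, u0)" "x0 \<in> closure \<Omega>" "0 < u0" by auto
  then have l: "0 < l"
    using f_partial[OF F, of x0 u0] f_deriv_neg[of x0 u0] DERIV_imp_deriv by (fastforce simp: l_def)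
  have mvt: "\<exists>c. l \<le> c \<and> c \<le> L \<and> f x t - f x s = - c * (t - s)"
    if x: "x \<in> closure \<Omega>" and st: "m x / 2 \<le> s" "s < t" "t \<le> 2 * m x" for x s t
  proof -
    have s0: "0 < s" using m_pos[OF x] st by simp
    obtain z where z: "s < z" "z < t" "f x t - f x s = (t - s) * snd (F (x, z))"
      using MVT2[OF st(2), of "f x" "\<lambda>u. snd (F (x, u))"] f_partial[OF F x] s0 by force
    have "(x, z) \<in> Z" using z st by (intro Z_in x) auto
    then have "l \<le> - snd (F (x, z))" "- snd (F (x, z)) \<le> L"
      using z0(2) z1(2) by (auto simp: l_def L_def)
    then show ?thesis using z(3) by (intro exI[of _ "- snd (F (x, z))"]) simp
  qed
  show ?thesis
  proof (rule exI[of _ l], rule exI[of _ L], intro conjI l ballI allI impI)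
    fix x s assume x: "x \<in> closure \<Omega>" and s': "m x / 2 \<le> s \<and> s \<le> m x"
    then have s: "m x / 2 \<le> s" "s \<le> m x" by auto
    have "l * (m x - s) \<le> f x s \<and> f x s \<le> L * (m x - s)"
    proof (cases "s = m x")
      case False
      then obtain c where c: "l \<le> c" "c \<le> L" "f x (m x) - f x s = - c * (m x - s)"
        using mvt[OF x, of s "m x"] s m_pos[OF x] by auto
      then have "f x s = c * (m x - s)" by (simp add: f_m_zero[OF x])
      then show ?thesis using c s by (simp add: mult_right_mono)
    qed (simp add: f_m_zero[OF x])
    then show "l * (m x - s) \<le> f x s" "f x s \<le> L * (m x - s)" by auto
  next
    fix x s assume x: "x \<in> closure \<Omega>" and s': "m x \<le> s \<and> s \<le> 2 * m x"
    then have s: "m x \<le> s" "s \<le> 2 * m x" by auto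
    have "l * (s - m x) \<le> - f x s \<and> - f x s \<le> L * (s - m x)"
    proof (cases "s = m x")
      case False
      then obtain c where c: "l \<le> c" "c \<le> L" "f x s - f x (m x) = - c * (s - m x)"
        using mvt[OF x, of "m x" s] s m_pos[OF x] by auto
      then have "- f x s = c * (s - m x)" by (simp add: f_m_zero[OF x])
      then show ?thesis using c s by (simp add: mult_right_mono)
    qed (simp add: f_m_zero[OF x])
    then show "l * (s - m x) \<le> - f x s" "- f x s \<le> L * (s - m x)" by auto
  qed
qed

text \<open>\<open>E x s\<close> is the integral of \<open>f x\<close> from \<open>s\<close> to \<open>m x\<close>, and \<open>f x\<close> is monotone.\<close>

lemma E_le:
  assumes x: "x \<in> \<Omega>" and s: "0 < s"
  shows "E x s \<le> (m x - s) * f x s"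
proof -
  have m: "0 < m x" using x by (intro m_pos in_closure)
  consider "s < m x" | "s = m x" | "m x < s" by linarith
  then show ?thesis
  proof cases
    case 1
    obtain z where z: "s < z" "z < m x" "E x (m x) - E x s = (m x - s) * (- f x z)"
      using MVT2[OF 1, of "E x" "\<lambda>u. - f x u"] E_deriv[OF x] s by force
    have "(m x - s) * f x z \<le> (m x - s) * f x s"
      using f_antimono[OF in_closure[OF x] s, of z] z 1 by (intro mult_left_mono) auto
    then show ?thesis using z(3) E_m[OF x] by simp
  next
    case 2
    then show ?thesis using E_m[OF x] by simp
  next
    case 3
    obtain z where z: "m x < z" "z < s" "E x s - E x (m x) = (s - m x) * (- f x z)"
      using MVT2[OF 3, of "E x" "\<lambda>u. - f x u"] E_deriv[OF x] m by force
    have "(s - m x) * (- f x z) \<le> (s - m x) * (- f x s)"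
      using f_antimono[OF in_closure[OF x], of z s] z 3 m by (intro mult_left_mono) auto
    then show ?thesis using z(3) E_m[OF x] by (simp add: algebra_simps)
  qed
qed

text \<open>The value \<open>K / 2\<close> for \<open>s \<le> c\<close> is the one that \<open>trunc K\<close> takes on large arguments. The distinction fixes the
value at \<open>s = 0\<close>, where \<open>f x\<close> is arbitrary.\<close>

definition truncated_f :: "real \<Rightarrow> real \<Rightarrow> 'a \<Rightarrow> real \<Rightarrow> real" where
  "truncated_f K c x s = (if s \<le> c then K / 2 else trunc K (f x s))"

text \<open>Near \<open>m x\<close> everything follows from the linear bounds on \<open>f x\<close>. Where \<open>f x s \<ge> K\<close>, in particular for
\<open>s \<le> m x / 2\<close>, the truncated value is \<open>K / 2\<close> and the energy is bounded by compactness. For \<open>s \<ge> 2 m x\<close> the function \<open>-f x\<close> is bounded below by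
\<open>2 K\<close>, so that \<open>E x s \<le> (s - m x) (- f x s)\<close> is at most a multiple of \<open>s (f x s)\<^sup>2\<close>.\<close>

lemma truncated_f_comparable:
  obtains K c C where "0 < K" "0 < c" "1 \<le> C"
    "\<And>x s. x \<in> closure \<Omega> \<Longrightarrow> 0 < s \<Longrightarrow> s \<le> c \<Longrightarrow> K \<le> f x s"
    "\<And>x s. x \<in> \<Omega> \<Longrightarrow> 0 \<le> s \<Longrightarrow> comparable C s (m x) (truncated_f K c x s) (E x s)"
proof -
  obtain l L where l: "0 < l"
    and below: "\<And>x s. x \<in> closure \<Omega> \<Longrightarrow> m x / 2 \<le> s \<Longrightarrow> s \<le> m x \<Longrightarrow> l * (m x - s) \<le> f x s \<and> f x s \<le> L * (m x - s)"
    and above: "\<And>x s. x \<in> closure \<Omega> \<Longrightarrow> m x \<le> s \<Longrightarrow> s \<le> 2 * m x \<Longrightarrow> l * (s - m x) \<le> - f x s \<and> - f x s \<le> L * (s - m x)"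
    using f_near_m by blast
  obtain x0 where x0: "x0 \<in> closure \<Omega>" "\<forall>x\<in>closure \<Omega>. m x0 \<le> m x"
    using continuous_attains_inf[OF compact_closure_dom closure_dom_nonempty m_cont] by blast
  obtain x1 where x1: "x1 \<in> closure \<Omega>" "\<forall>x\<in>closure \<Omega>. m x \<le> m x1"
    using continuous_attains_sup[OF compact_closure_dom closure_dom_nonempty m_cont] by blast
  define m0 m1 where "m0 = m x0" and "m1 = m x1"
  have m0: "0 < m0" using m_pos[OF x0(1)] by (simp add: m0_def)
  have m_range: "m0 \<le> m x" "m x \<le> m1" if "x \<in> closure \<Omega>" for x
    using x0 x1 that by (auto simp: m0_def m1_def)
  have m1: "0 < m1" using m0 m_range[OF x0(1)] by simp
  have "compact (closure \<Omega> \<times> {0..m1})" by (intro compact_Times compact_closure_dom) auto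
  moreover have "closure \<Omega> \<times> {0..m1} \<noteq> {}" using closure_dom_nonempty m1 by auto
  moreover have "continuous_on (closure \<Omega> \<times> {0..m1}) (\<lambda>(x, u). E x u)"
    by (rule continuous_on_subset[OF E_cont]) auto
  ultimately obtain p where "p \<in> closure \<Omega> \<times> {0..m1}"
      "\<forall>q\<in>closure \<Omega> \<times> {0..m1}. (\<lambda>(x, u). E x u) q \<le> (\<lambda>(x, u). E x u) p"
    using continuous_attains_sup by blast
  then obtain e where e: "\<And>x s. x \<in> closure \<Omega> \<Longrightarrow> 0 \<le> s \<Longrightarrow> s \<le> m1 \<Longrightarrow> E x s \<le> e" by fastforce
  have e0: "0 \<le> e"
    using e[OF x0(1), of 0] E_nonneg[OF x0(1), of 0] m1 by simp
  \<comment> \<open>A common lower bound of \<open>f x (m x / 2)\<close> over all \<open>x\<close>.\<close>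
  define K where "K = l * m0 / 2"
  define c where "c = m0 / 2"
  \<comment> \<open>The sum of the constants that occur in the separate estimates.\<close>
  define C where "C = 1 + 4 / l + 2 * m1 / K + \<bar>L\<bar> + l + 1 / m0 + 1 / (2 * K) + 4 * e / K\<^sup>2 + m1"
  have K: "0 < K" using l m0 by (simp add: K_def)
  have parts: "0 \<le> 4 / l" "0 \<le> 2 * m1 / K" "0 \<le> 1 / m0" "0 \<le> 1 / (2 * K)" "0 \<le> 4 * e / K\<^sup>2"
    using l m1 K m0 e0 by auto
  have C: "1 \<le> C" "4 / l \<le> C" "2 * m1 / K \<le> C" "L \<le> C" "l \<le> C" "1 / m0 \<le> C"
      "1 / (2 * K) \<le> C" "4 * e / K\<^sup>2 \<le> C" "m1 \<le> C"
    unfolding C_def using parts l m1 by linarith+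
  have C2: "1 / l \<le> C" "2 / l \<le> C"
    using C(2) l by (auto intro!: order_trans[OF _ C(2)] divide_right_mono)
  have up: "t \<le> C * r" if "t \<le> k * r" "k \<le> C" "0 \<le> r" for t k r
    using that mult_right_mono[of k C r] by linarith
  have f_large: "K \<le> f x s" if "x \<in> closure \<Omega>" "0 < s" "s \<le> m x / 2" for x s
  proof -
    have "K \<le> l * (m x - m x / 2)" using m_range[OF that(1)] l by (simp add: K_def field_simps)
    also have "\<dots> \<le> f x (m x / 2)" using below[OF that(1), of "m x / 2"] m_pos[OF that(1)] by simp
    also have "\<dots> \<le> f x s" by (rule f_antimono[OF that])
    finally show ?thesis .
  qed
  have p_small: "truncated_f K c x s = K / 2" if "x \<in> closure \<Omega>" "0 \<le> s" "s \<le> m x / 2" for x s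
    using f_large[OF that(1), of s] that m0 K by (auto simp: truncated_f_def c_def trunc_const)
  have p_trunc: "truncated_f K c x s = trunc K (f x s)" if "x \<in> closure \<Omega>" "m x / 2 \<le> s" for x s
    using f_large[OF that(1), of s] that m_range(1)[OF that(1)] m0 K
    by (auto simp: truncated_f_def c_def trunc_const)
  have comp: "comparable C s (m x) (truncated_f K c x s) (E x s)" if x: "x \<in> \<Omega>" and s: "0 \<le> s" for x s
  proof -
    have xc: "x \<in> closure \<Omega>" using x by (rule in_closure)
    note mx = m_range[OF xc] m_pos[OF xc]
    define g where "g = truncated_f K c x s"
    have le_m1: "m x \<le> C" using mx(2) C(9) by linarith
    show ?thesis
    proof (cases "m x < s")
      case True
      have fs: "f x s < 0 \<and> min (- f x s) 1 \<le> C * (s - m x) \<and> s - m x \<le> C * ((1 + s) * (- f x s))"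
      proof (cases "s \<le> 2 * m x")
        case le: True
        have ab: "l * (s - m x) \<le> - f x s" "- f x s \<le> L * (s - m x)" using above[OF xc _ le] True by auto
        have "0 < l * (s - m x)" using l True by simp
        then have neg: "f x s < 0" using ab by linarith
        have "s - m x \<le> 1 / l * (- f x s)" using ab(1) l by (simp add: field_simps)
        also have "\<dots> \<le> C * (- f x s)" using C2(1) neg by (intro mult_right_mono) auto
        also have "\<dots> \<le> C * ((1 + s) * (- f x s))"
          using C(1) s neg by (intro mult_left_mono) (auto simp: algebra_simps mult_le_0_iff)
        finally show ?thesis using neg up[OF ab(2) C(4)] True by auto
      next
        case False
        have "l * m0 \<le> l * m x" using mx(1) l by simp
        also have "\<dots> \<le> - f x (2 * m x)" using above[OF xc, of "2 * m x"] mx(3) by simp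
        also have "\<dots> \<le> - f x s" using f_antimono[OF xc, of "2 * m x" s] False mx(3) by simp
        finally have big: "2 * K \<le> - f x s" by (simp add: K_def)
        then have neg: "f x s < 0" using K by linarith
        have "1 \<le> 1 / m0 * (s - m x)" using False mx m0 by (simp add: field_simps)
        then have one: "1 \<le> C * (s - m x)" using up[OF _ C(6)] True by auto
        have "1 \<le> 1 / (2 * K) * (- f x s)" using big K by (simp add: field_simps)
        then have "1 \<le> C * (- f x s)" by (rule up[OF _ C(7)]) (use neg in simp)
        then have "s * 1 \<le> s * (C * (- f x s))" using s by (intro mult_left_mono)
        also have "\<dots> \<le> C * ((1 + s) * (- f x s))"
          using C(1) neg mult_nonneg_nonpos[of C "f x s"] by (simp add: algebra_simps)
        finally show ?thesis using neg one mx(3) by auto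
      qed
      have g: "g = f x s" using p_trunc[OF xc] True mx(3) fs K by (simp add: g_def trunc_nonpos)
      have "E x s \<le> (s - m x) * (- f x s)" using E_le[OF x, of s] True mx(3) by (simp add: algebra_simps)
      also have "\<dots> \<le> (C * ((1 + s) * (- f x s))) * (- f x s)" using fs by (intro mult_right_mono) auto
      also have "\<dots> = C * ((1 + s) * g\<^sup>2)" by (simp add: g power2_eq_square)
      finally show ?thesis using fs True le_m1 by (simp add: comparable_def g[symmetric] g_def[symmetric])
    next
      case False
      then have sm: "s \<le> m x" by simp
      have Ee: "E x s \<le> C * g\<^sup>2" if "g = K / 2"
      proof (rule up[OF _ C(8)])
        have "E x s \<le> e" using sm mx s by (intro e xc) auto
        then show "E x s \<le> 4 * e / K\<^sup>2 * g\<^sup>2" using K by (simp add: that power2_eq_square field_simps)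
      qed simp
      have mg: "m x - s \<le> C * g" if "g = K / 2"
      proof (rule up[OF _ C(3)])
        show "m x - s \<le> 2 * m1 / K * g" using s mx K by (simp add: that)
      qed (use K that in simp)
      have main: "m x - s \<le> C * g \<and> g \<le> C * (m x - s) \<and> E x s \<le> C * g\<^sup>2"
      proof (cases "s \<le> m x / 2")
        case True
        have gK: "g = K / 2" using p_small[OF xc s True] by (simp add: g_def)
        have "K / 2 \<le> l * m x / 4" using mx(1) l by (simp add: K_def)
        also have "\<dots> \<le> l * (m x - s)" using True l mx(3) by (simp add: field_simps)
        finally have "g \<le> C * (m x - s)" using up[OF _ C(5)] sm gK by auto
        then show ?thesis using Ee mg gK by auto
      next
        case half: False
        have ab: "l * (m x - s) \<le> f x s" "f x s \<le> L * (m x - s)" using below[OF xc _ sm] half by auto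
        have s0: "0 < s" using half mx(3) by linarith
        have g: "g = trunc K (f x s)" using p_trunc[OF xc] half by (simp add: g_def)
        have f0: "0 \<le> f x s" using ab(1) l sm by (smt (verit) mult_nonneg_nonneg)
        show ?thesis
        proof (cases "f x s \<le> K")
          case True
          have gf: "f x s / 2 \<le> g" "g \<le> f x s" using trunc_mid[OF K f0 True] by (auto simp: g)
          have g0: "0 \<le> g" using f0 gf by linarith
          have ml: "m x - s \<le> 2 / l * g" using ab(1) gf(1) l by (simp add: field_simps)
          have "E x s \<le> (m x - s) * f x s" by (rule E_le[OF x s0])
          also have "\<dots> \<le> (2 / l * g) * (2 * g)" using ml gf f0 sm g0 l by (intro mult_mono) auto
          also have "\<dots> = 4 / l * g\<^sup>2" by (simp add: power2_eq_square)
          finally have "E x s \<le> C * g\<^sup>2" by (rule up[OF _ C(2)]) simp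
          moreover have "g \<le> C * (m x - s)" using up[OF _ C(4), of g "m x - s"] gf(2) ab(2) sm by auto
          ultimately show ?thesis using up[OF ml C2(2) g0] by simp
        next
          case False
          then have gK: "g = K / 2" using K by (simp add: g trunc_const)
          have "g \<le> L * (m x - s)" using gK False K ab(2) by linarith
          then show ?thesis using Ee mg gK up[OF _ C(4)] sm by auto
        qed
      qed
      have "C * g\<^sup>2 \<le> C * ((1 + s) * g\<^sup>2)" using C(1) s by (intro mult_left_mono) (auto simp: distrib_right)
      then show ?thesis using main sm le_m1 by (simp add: comparable_def g_def)
    qed
  qed
  show thesis
  proof (rule that[OF K _ C(1) _ comp])
    show "0 < c" using m0 by (simp add: c_def)
    show "K \<le> f x s" if "x \<in> closure \<Omega>" "0 < s" "s \<le> c" for x s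
      using f_large[of x s] that m_range(1)[of x] by (simp add: c_def)
  qed
qed

end

lemma grad_eqI:
  assumes "(g has_derivative (\<lambda>h. D \<bullet> h)) (at x)"
  shows "grad g x = D"
  unfolding grad_def
proof (rule the_equality)
  show "GDERIV g x :> D" using assms by (simp add: gderiv_def inner_commute)
  fix D' assume "GDERIV g x :> D'"
  then have "(g has_derivative (\<lambda>h. D' \<bullet> h)) (at x)" by (simp add: gderiv_def inner_commute)
  from has_derivative_unique[OF this assms] have "D' \<bullet> h = D \<bullet> h" for h by metis
  then show "D' = D" using vector_eq_rdot[of D' D] by blast
qed

context free_energy
begin

lemma has_derivative_f_compose:
  assumes F: "joint_gradient F" and x: "x \<in> \<Omega>" and u: "0 < u x"
    and du: "(u has_derivative (\<lambda>h. D \<bullet> h)) (at x)"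
  shows "((\<lambda>y. f y (u y)) has_derivative (\<lambda>h. (fst (F (x, u x)) + snd (F (x, u x)) *\<^sub>R D) \<bullet> h)) (at x)"
proof -
  have "((\<lambda>(x, u). f x u) has_derivative (\<lambda>h. F (x, u x) \<bullet> h)) (at (x, u x) within \<Omega> \<times> {0<..})"
    by (rule has_derivative_subset[where s = "closure \<Omega> \<times> {0<..}"])
       (use F x u in_closure in \<open>auto simp: joint_gradient_def\<close>)
  moreover have "open (\<Omega> \<times> {0::real<..})" by (intro open_Times open_dom open_greaterThan)
  ultimately have "((\<lambda>(x, u). f x u) has_derivative (\<lambda>h. F (x, u x) \<bullet> h)) (at (x, u x))"
    using x u at_within_open[of "(x, u x)" "\<Omega> \<times> {0::real<..}"] by simp
  moreover have "((\<lambda>y. (y, u y)) has_derivative (\<lambda>h. (h, D \<bullet> h))) (at x)"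
    by (intro has_derivative_Pair has_derivative_ident du)
  ultimately have "((\<lambda>y. f y (u y)) has_derivative (\<lambda>h. F (x, u x) \<bullet> (h, D \<bullet> h))) (at x)"
    using has_derivative_compose[of "\<lambda>y. (y, u y)" _ x UNIV "\<lambda>(x, u). f x u"] by simp
  moreover have "F (x, u x) \<bullet> (h, D \<bullet> h) = (fst (F (x, u x)) + snd (F (x, u x)) *\<^sub>R D) \<bullet> h" for h
    by (simp add: inner_prod_def inner_add_left)
  ultimately show ?thesis by simp
qed

text \<open>The sets where \<open>u > 0\<close> and where \<open>u < c\<close> are open and cover \<open>\<Omega>\<close>. On the first the chain rule applies, and on
the second the truncated function is constant.\<close>

lemma truncated_f_C1_fun:
  assumes K: "0 < K" and c: "0 < c"
    and large: "\<And>x s. x \<in> closure \<Omega> \<Longrightarrow> 0 < s \<Longrightarrow> s \<le> c \<Longrightarrow> K \<le> f x s"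
    and du: "\<And>x. x \<in> \<Omega> \<Longrightarrow> (u has_derivative (\<lambda>h. Du x \<bullet> h)) (at x)"
    and du_cont: "continuous_on \<Omega> Du"
    and u_nonneg: "\<And>x. x \<in> \<Omega> \<Longrightarrow> 0 \<le> u x"
  shows "\<exists>g G. C1_fun \<Omega> g G \<and> (\<forall>x\<in>\<Omega>. g x = truncated_f K c x (u x) \<and>
      c * (norm (G x))\<^sup>2 \<le> u x * (norm (grad (\<lambda>y. f y (u y)) x))\<^sup>2)"
proof -
  obtain F where F: "joint_gradient F" using joint_gradient_exists by blast
  have u_cont: "continuous_on \<Omega> u"
    by (intro continuous_at_imp_continuous_on ballI has_derivative_continuous[OF du])
  define \<phi> where "\<phi> x = f x (u x)" for x
  define D where "D x = fst (F (x, u x)) + snd (F (x, u x)) *\<^sub>R Du x" for x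
  define g where "g x = (if x \<in> \<Omega> then truncated_f K c x (u x) else 0)" for x
  define G where "G x = (if x \<in> \<Omega> \<and> c < u x then trunc' K (\<phi> x) *\<^sub>R D x else 0)" for x
  define A B where "A = {x \<in> \<Omega>. 0 < u x}" and "B = {x \<in> \<Omega>. u x < c}"
  have AB_eq: "A = \<Omega> \<inter> u -` {0<..}" "B = \<Omega> \<inter> u -` {..<c}"
    by (auto simp: A_def B_def)
  have AB_open: "open A" "open B"
    unfolding AB_eq by (rule continuous_open_preimage[OF u_cont open_dom]; simp)+
  have AB: "A \<union> B = \<Omega>" using u_nonneg c by (force simp: A_def B_def)
  have D_phi: "(\<phi> has_derivative (\<lambda>h. D x \<bullet> h)) (at x)" if "x \<in> A" for x
    unfolding \<phi>_def D_def using that by (intro has_derivative_f_compose F du) (auto simp: A_def)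
  have phi_large: "K \<le> \<phi> x" if "x \<in> A" "u x \<le> c" for x
    using large[OF in_closure, of x "u x"] that by (simp add: \<phi>_def A_def)
  have g_A: "g x = trunc K (\<phi> x)" if "x \<in> A" for x
    using that phi_large[OF that] K by (auto simp: g_def truncated_f_def A_def \<phi>_def trunc_const)
  have G_A: "G x = trunc' K (\<phi> x) *\<^sub>R D x" if "x \<in> A" for x
    using that phi_large[OF that] K by (auto simp: G_def A_def trunc'_const)
  have g_B: "g x = K / 2" and G_B: "G x = 0" if "x \<in> B" for x
    using that by (auto simp: g_def G_def B_def truncated_f_def)
  have deriv: "(g has_derivative (\<lambda>h. G x \<bullet> h)) (at x)" if "x \<in> \<Omega>" for x
  proof (cases "x \<in> A")
    case True
    have "((\<lambda>x. trunc K (\<phi> x)) has_derivative (\<lambda>h. trunc' K (\<phi> x) * (D x \<bullet> h))) (at x)"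
      using has_derivative_compose[OF D_phi[OF True] DERIV_trunc[unfolded has_field_derivative_def]] .
    then have "((\<lambda>x. trunc K (\<phi> x)) has_derivative (\<lambda>h. G x \<bullet> h)) (at x)"
      by (simp add: G_A[OF True])
    then show ?thesis
      by (rule has_derivative_transform_within_open[OF _ AB_open(1) True]) (simp add: g_A)
  next
    case False
    then have x: "x \<in> B" using AB that by blast
    have "((\<lambda>x. K / 2) has_derivative (\<lambda>h. G x \<bullet> h)) (at x)" by (simp add: G_B[OF x])
    then show ?thesis
      by (rule has_derivative_transform_within_open[OF _ AB_open(2) x]) (simp add: g_B)
  qed
  have pair_cont: "continuous_on A (\<lambda>x. (x, u x))"
    by (intro continuous_intros continuous_on_subset[OF u_cont]) (auto simp: A_def)
  have pair_im: "(\<lambda>x. (x, u x)) ` A \<subseteq> closure \<Omega> \<times> {0<..}"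
    using in_closure by (auto simp: A_def)
  have "continuous_on A (\<lambda>x. F (x, u x))"
    using F pair_im by (intro continuous_on_compose2[OF _ pair_cont]) (auto simp: joint_gradient_def)
  moreover have "continuous_on A Du" by (rule continuous_on_subset[OF du_cont]) (auto simp: A_def)
  ultimately have "continuous_on A D" unfolding D_def by (intro continuous_intros)
  moreover have "continuous_on A \<phi>"
    unfolding \<phi>_def using continuous_on_compose2[OF f_joint_cont pair_cont pair_im] by simp
  ultimately have "continuous_on A (\<lambda>x. trunc' K (\<phi> x) *\<^sub>R D x)"
    by (intro continuous_on_scaleR continuous_on_compose2[OF continuous_on_trunc'[of UNIV]]) auto
  then have "continuous_on A G" using G_A by (simp cong: continuous_on_cong)
  moreover have "continuous_on B G" using G_B by (simp cong: continuous_on_cong)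
  ultimately have G_cont: "continuous_on \<Omega> G"
    using continuous_on_open_Un[OF AB_open] AB by simp
  have g_cont: "continuous_on \<Omega> g"
    by (intro continuous_at_imp_continuous_on ballI has_derivative_continuous[OF deriv])
  have "(\<lambda>x. indicator \<Omega> x *\<^sub>R g x) \<in> borel_measurable borel" "(\<lambda>x. indicator \<Omega> x *\<^sub>R G x) \<in> borel_measurable borel"
    by (intro borel_measurable_continuous_on_indicator borel_open open_dom g_cont G_cont)+
  moreover have "(\<lambda>x. indicator \<Omega> x *\<^sub>R g x) = g" "(\<lambda>x. indicator \<Omega> x *\<^sub>R G x) = G"
    by (auto simp: g_def G_def indicator_def)
  ultimately have "C1_fun \<Omega> g G" using G_cont deriv by (simp add: C1_fun_def)
  moreover have "c * (norm (G x))\<^sup>2 \<le> u x * (norm (grad (\<lambda>y. f y (u y)) x))\<^sup>2" if x: "x \<in> \<Omega>" for x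
  proof (cases "c < u x")
    case True
    then have A: "x \<in> A" using x c by (simp add: A_def)
    have "grad (\<lambda>y. f y (u y)) x = D x" using D_phi[OF A] unfolding \<phi>_def by (rule grad_eqI)
    moreover have "norm (G x) \<le> norm (D x)"
      using trunc'_range[OF K, of "\<phi> x"] by (auto simp: G_A[OF A] intro!: mult_left_le_one_le)
    ultimately show ?thesis using True c by (intro mult_mono power_mono) auto
  next
    case False
    then show ?thesis using u_nonneg[OF x] by (simp add: G_def)
  qed
  ultimately show ?thesis by (intro exI[of _ g] exI[of _ G]) (auto simp: g_def)
qed

end

section \<open>Integral estimates\<close>

text \<open>On the set where \<open>u \<ge> \<eta>\<close> the weighted integral controls \<open>g - b\<close> without the weight. Any other point \<open>x\<close> is
compared with the points \<open>y\<close> of this set by \<open>(g x - b)\<^sup>2 \<le> 2 (g x - g y)\<^sup>2 + 2 (g y - b)\<^sup>2\<close>. The constant depends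
on \<open>u\<close> only through \<open>\<eta>\<close> and \<open>\<delta>\<close>.\<close>

lemma weighted_poincare:
  fixes \<Omega> :: "'a::euclidean_space set"
  assumes \<Omega>: "\<Omega> \<in> sets borel" "bounded \<Omega>" and link: "linked \<Omega> \<Omega> \<Omega>"
    and \<eta>: "0 < \<eta>" and \<delta>: "0 < \<delta>"
  shows "\<exists>C\<ge>0. \<forall>g G u b. C1_fun \<Omega> g G \<longrightarrow> (\<forall>x\<in>\<Omega>. 0 \<le> u x) \<longrightarrow>
    {x \<in> \<Omega>. \<eta> \<le> u x} \<in> sets borel \<longrightarrow> ennreal \<delta> \<le> emeasure lborel {x \<in> \<Omega>. \<eta> \<le> u x} \<longrightarrow>
    (\<integral>\<^sup>+x\<in>\<Omega>. ennreal ((g x - b)\<^sup>2) \<partial>lborel) \<le>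
      ennreal C * ((\<integral>\<^sup>+x\<in>\<Omega>. ennreal (u x * (g x - b)\<^sup>2) \<partial>lborel) + energy \<Omega> G)"
proof -
  note [measurable] = \<Omega>(1)
  obtain C where C: "0 \<le> C" "\<forall>g G. C1_fun \<Omega> g G \<longrightarrow> variation \<Omega> \<Omega> g \<le> ennreal C * energy \<Omega> G"
    using linked_nonneg_const[OF link] by blast
  define \<mu> where "\<mu> = measure lborel \<Omega>"
  have em: "emeasure lborel \<Omega> = ennreal \<mu>" "0 \<le> \<mu>"
    unfolding \<mu>_def using emeasure_bounded_finite[OF \<Omega>(2)] by (auto intro!: emeasure_eq_ennreal_measure)
  define C' where "C' = 1 / \<delta> * (2 * C + 2 * \<mu> / \<eta>)"
  have C'0: "0 \<le> C'" using C(1) em(2) \<eta> \<delta> by (simp add: C'_def)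
  show ?thesis
  proof (intro exI[of _ C'] conjI C'0 allI impI)
    fix g G u b
    assume C1: "C1_fun \<Omega> g G" and u: "\<forall>x\<in>\<Omega>. 0 \<le> u x"
      and S_meas: "{x \<in> \<Omega>. \<eta> \<le> u x} \<in> sets borel"
      and S_large: "ennreal \<delta> \<le> emeasure lborel {x \<in> \<Omega>. \<eta> \<le> u x}"
    define S where "S = {x \<in> \<Omega>. \<eta> \<le> u x}"
    have [measurable]: "S \<in> sets borel" "g \<in> borel_measurable borel"
      using S_meas C1 by (auto simp: S_def C1_fun_def)
    let ?\<chi> = "\<lambda>A x. indicator A x :: ennreal"
    define Q where "Q x = ennreal ((g x - b)\<^sup>2)" for x
    define D where "D x y = ennreal ((g x - g y)\<^sup>2)" for x y
    define A where "A = (\<integral>\<^sup>+x\<in>\<Omega>. ennreal (u x * (g x - b)\<^sup>2) \<partial>lborel)"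
    have [measurable]: "Q \<in> borel_measurable borel" unfolding Q_def by measurable
    have [measurable]: "(\<lambda>(x, y). D x y) \<in> borel_measurable (borel \<Otimes>\<^sub>M borel)"
      unfolding D_def by measurable
    have Q_le: "Q x \<le> 2 * D x y + 2 * Q y" for x y
    proof -
      have "(g x - b)\<^sup>2 \<le> 2 * (g x - g y)\<^sup>2 + 2 * (g y - b)\<^sup>2"
        using zero_le_power2[of "(g x - g y) - (g y - b)"] by (simp add: power2_eq_square algebra_simps)
      then have "Q x \<le> ennreal (2 * (g x - g y)\<^sup>2 + 2 * (g y - b)\<^sup>2)"
        unfolding Q_def by (rule ennreal_leI)
      also have "\<dots> = 2 * D x y + 2 * Q y" unfolding D_def Q_def by (simp add: ennreal_mult)
      finally show ?thesis .
    qed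
    have "ennreal \<eta> * (\<integral>\<^sup>+y. Q y * ?\<chi> S y \<partial>lborel) = (\<integral>\<^sup>+y. ennreal \<eta> * (Q y * ?\<chi> S y) \<partial>lborel)"
      by (intro nn_integral_cmult[symmetric]) measurable
    also have "\<dots> \<le> A" unfolding A_def
    proof (intro nn_integral_mono)
      fix y
      show "ennreal \<eta> * (Q y * ?\<chi> S y) \<le> ennreal (u y * (g y - b)\<^sup>2) * ?\<chi> \<Omega> y"
        using \<eta> u unfolding Q_def S_def
        by (auto simp: indicator_def ennreal_mult[symmetric] intro!: ennreal_leI mult_right_mono)
    qed
    finally have QA: "ennreal \<eta> * (\<integral>\<^sup>+y. Q y * ?\<chi> S y \<partial>lborel) \<le> A" .
    have "ennreal \<delta> * (\<integral>\<^sup>+x\<in>\<Omega>. Q x \<partial>lborel) \<le> emeasure lborel S * (\<integral>\<^sup>+x\<in>\<Omega>. Q x \<partial>lborel)"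
      using S_large by (intro mult_right_mono) (auto simp: S_def)
    also have "\<dots> = (\<integral>\<^sup>+x. (\<integral>\<^sup>+y. Q x * ?\<chi> \<Omega> x * ?\<chi> S y \<partial>lborel) \<partial>lborel)"
      by (simp add: nn_integral_cmult_indicator nn_integral_multc mult.commute[of "emeasure lborel S"])
    also have "\<dots> \<le> (\<integral>\<^sup>+x. (\<integral>\<^sup>+y. 2 * (D x y * ?\<chi> \<Omega> y * ?\<chi> \<Omega> x) + 2 * (Q y * ?\<chi> S y * ?\<chi> \<Omega> x) \<partial>lborel) \<partial>lborel)"
      using Q_le by (intro nn_integral_mono) (auto simp: indicator_def S_def)
    also have "\<dots> = 2 * (\<integral>\<^sup>+x. (\<integral>\<^sup>+y. D x y * ?\<chi> \<Omega> y * ?\<chi> \<Omega> x \<partial>lborel) \<partial>lborel) +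
        2 * (\<integral>\<^sup>+x. (\<integral>\<^sup>+y. Q y * ?\<chi> S y * ?\<chi> \<Omega> x \<partial>lborel) \<partial>lborel)"
      by (simp add: nn_integral_add nn_integral_cmult)
    also have "(\<integral>\<^sup>+x. (\<integral>\<^sup>+y. D x y * ?\<chi> \<Omega> y * ?\<chi> \<Omega> x \<partial>lborel) \<partial>lborel) = variation \<Omega> \<Omega> g"
      unfolding variation_def D_def by (intro nn_integral_cong nn_integral_multc) measurable
    also have "(\<integral>\<^sup>+x. (\<integral>\<^sup>+y. Q y * ?\<chi> S y * ?\<chi> \<Omega> x \<partial>lborel) \<partial>lborel) =
        ennreal \<mu> * (\<integral>\<^sup>+y. Q y * ?\<chi> S y \<partial>lborel)"
      by (simp add: nn_integral_multc nn_integral_cmult_indicator em mult.commute[of "ennreal \<mu>"])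
    also have "ennreal \<mu> * (\<integral>\<^sup>+y. Q y * ?\<chi> S y \<partial>lborel) =
        ennreal (\<mu> / \<eta>) * (ennreal \<eta> * (\<integral>\<^sup>+y. Q y * ?\<chi> S y \<partial>lborel))"
      using \<eta> em(2) by (simp add: mult.assoc[symmetric] ennreal_mult[symmetric])
    also have "2 * variation \<Omega> \<Omega> g + 2 * \<dots> \<le> 2 * (ennreal C * energy \<Omega> G) + 2 * (ennreal (\<mu> / \<eta>) * A)"
      using C(2) C1 QA by (intro add_mono mult_left_mono) auto
    also have "\<dots> \<le> 2 * (ennreal C * (A + energy \<Omega> G)) + 2 * (ennreal (\<mu> / \<eta>) * (A + energy \<Omega> G))"
      by (intro add_mono mult_left_mono) auto
    also have "\<dots> = ennreal (2 * C + 2 * \<mu> / \<eta>) * (A + energy \<Omega> G)"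
    proof -
      have "ennreal (2 * C + 2 * \<mu> / \<eta>) = 2 * ennreal C + 2 * ennreal (\<mu> / \<eta>)"
        using C(1) em(2) \<eta> by (subst ennreal_plus) (auto simp: ennreal_mult' times_divide_eq_right[symmetric] simp del: times_divide_eq_right)
      then show ?thesis by (simp only: distrib_right mult.assoc)
    qed
    finally have "ennreal (1 / \<delta>) * (ennreal \<delta> * (\<integral>\<^sup>+x\<in>\<Omega>. Q x \<partial>lborel)) \<le>
        ennreal (1 / \<delta>) * (ennreal (2 * C + 2 * \<mu> / \<eta>) * (A + energy \<Omega> G))"
      by (rule mult_left_mono) simp
    moreover have "ennreal (1 / \<delta>) * (ennreal \<delta> * (\<integral>\<^sup>+x\<in>\<Omega>. Q x \<partial>lborel)) = (\<integral>\<^sup>+x\<in>\<Omega>. Q x \<partial>lborel)"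
      using \<delta> by (simp add: mult.assoc[symmetric] ennreal_mult[symmetric])
    moreover have "ennreal (1 / \<delta>) * (ennreal (2 * C + 2 * \<mu> / \<eta>) * (A + energy \<Omega> G)) = ennreal C' * (A + energy \<Omega> G)"
    proof -
      have "ennreal C' = ennreal (1 / \<delta>) * ennreal (2 * C + 2 * \<mu> / \<eta>)"
        unfolding C'_def using \<delta> by (intro ennreal_mult') simp
      then show ?thesis by (simp only: mult.assoc)
    qed
    ultimately show "(\<integral>\<^sup>+x\<in>\<Omega>. ennreal ((g x - b)\<^sup>2) \<partial>lborel) \<le>
      ennreal C' * ((\<integral>\<^sup>+x\<in>\<Omega>. ennreal (u x * (g x - b)\<^sup>2) \<partial>lborel) + energy \<Omega> G)"
      by (simp add: Q_def A_def)
  qed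
qed

text \<open>Integrating the inequality of \<open>comparable_level\<close> removes the term with \<open>k\<close>, because \<open>u\<close> and \<open>w\<close> have the same
mass. The Cauchy-Schwarz inequality for the measure with density \<open>1 + u\<close>, whose mass is that of \<open>M\<close> plus \<open>1\<close>, then
bounds \<open>b\<^sup>2\<close>, and \<open>g\<^sup>2 \<le> 2 (g - b)\<^sup>2 + 2 b\<^sup>2\<close> finishes the proof.\<close>

lemma (in finite_measure) comparable_integral_le:
  fixes u w g e :: "'a \<Rightarrow> real"
  assumes C: "1 \<le> C" and pos: "0 < measure M (space M)"
    and [measurable]: "g \<in> borel_measurable M"
    and u: "integrable M u" "(\<integral>x. u x \<partial>M) = 1" "\<And>x. x \<in> space M \<Longrightarrow> 0 \<le> u x"
    and w: "integrable M w" "(\<integral>x. w x \<partial>M) = 1"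
    and comp: "\<And>x. x \<in> space M \<Longrightarrow> comparable C (u x) (w x) (g x) (e x)"
  shows "(\<integral>\<^sup>+x. ennreal (e x) \<partial>M) \<le>
    ennreal (2 * C * (1 + ((measure M (space M) + 1) * (1 + C\<^sup>2) / measure M (space M))\<^sup>2)) *
      (\<integral>\<^sup>+x. ennreal ((1 + u x) * (g x - b)\<^sup>2) \<partial>M)"
proof (cases "(\<integral>\<^sup>+x. ennreal ((1 + u x) * (g x - b)\<^sup>2) \<partial>M) = \<infinity>")
  case True
  define X where "X = 2 * C * (1 + ((measure M (space M) + 1) * (1 + C\<^sup>2) / measure M (space M))\<^sup>2)"
  have "0 < X" unfolding X_def using C by (intro mult_pos_pos add_pos_nonneg) auto
  then show ?thesis unfolding True X_def[symmetric] by (simp add: ennreal_mult_top)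
next
  case False
  define \<mu> where "\<mu> = measure M (space M)"
  define B where "B = 1 + C\<^sup>2"
  have \<mu>: "0 < \<mu>" using pos by (simp add: \<mu>_def)
  have [measurable]: "u \<in> borel_measurable M" "w \<in> borel_measurable M" using u w by auto
  have int1: "integrable M (\<lambda>x. 1 + u x)" using u(1) by auto
  have val1: "(\<integral>x. 1 + u x \<partial>M) = \<mu> + 1" using u by (simp add: \<mu>_def)
  have int2: "integrable M (\<lambda>x. (1 + u x) * (g x - b)\<^sup>2)"
    using False u(3) by (intro integrableI_nonneg) (auto simp: less_top intro!: AE_I2)
  define W where "W = (\<integral>x. (1 + u x) * (g x - b)\<^sup>2 \<partial>M)"
  have W: "(\<integral>\<^sup>+x. ennreal ((1 + u x) * (g x - b)\<^sup>2) \<partial>M) = ennreal W"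
    unfolding W_def using u(3) by (intro nn_integral_eq_integral int2) (auto intro!: AE_I2)
  have int3: "integrable M (\<lambda>x. (1 + u x) * \<bar>g x - b\<bar>)"
  proof (rule Bochner_Integration.integrable_bound[OF Bochner_Integration.integrable_add[OF int1 int2]])
    show "AE x in M. norm ((1 + u x) * \<bar>g x - b\<bar>) \<le> norm (1 + u x + (1 + u x) * (g x - b)\<^sup>2)"
    proof (intro AE_I2)
      fix x assume "x \<in> space M"
      then have u0: "0 \<le> 1 + u x" using u(3) by simp
      have "t \<le> 1 + t\<^sup>2" for t :: real
        using zero_le_power2[of "t - 1 / 2"] by (simp add: power2_eq_square algebra_simps)
      from this[of "\<bar>g x - b\<bar>"] have "\<bar>g x - b\<bar> \<le> 1 + (g x - b)\<^sup>2" by simp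
      then have "(1 + u x) * \<bar>g x - b\<bar> \<le> (1 + u x) * (1 + (g x - b)\<^sup>2)"
        using u0 by (intro mult_left_mono)
      then show "norm ((1 + u x) * \<bar>g x - b\<bar>) \<le> norm (1 + u x + (1 + u x) * (g x - b)\<^sup>2)"
        using u0 by (simp add: abs_mult distrib_left)
    qed
  qed measurable
  define I where "I = (\<integral>x. (1 + u x) * \<bar>g x - b\<bar> \<partial>M)"
  have I_sq: "I\<^sup>2 \<le> (\<mu> + 1) * W"
  proof -
    \<comment> \<open>Cauchy-Schwarz, as nonnegativity of the variance: \<open>t\<close> is the mean of \<open>|g - b|\<close>.\<close>
    define t where "t = I / (\<mu> + 1)"
    have "0 \<le> (\<integral>x. (1 + u x) * (\<bar>g x - b\<bar> - t)\<^sup>2 \<partial>M)"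
      using u(3) by (intro integral_nonneg_AE AE_I2) auto
    also have "\<dots> = (\<integral>x. (1 + u x) * (g x - b)\<^sup>2 - (2 * t) * ((1 + u x) * \<bar>g x - b\<bar>) + t\<^sup>2 * (1 + u x) \<partial>M)"
      by (intro Bochner_Integration.integral_cong refl) (simp add: power2_diff algebra_simps)
    also have "\<dots> = W - 2 * t * I + t\<^sup>2 * (\<mu> + 1)"
      using int1 int2 int3 unfolding W_def I_def val1[symmetric]
      by (subst Bochner_Integration.integral_add Bochner_Integration.integral_diff; simp)+
    finally have W_ge: "0 \<le> W - 2 * t * I + t\<^sup>2 * (\<mu> + 1)" .
    have I_t: "I = t * (\<mu> + 1)" using \<mu> by (simp add: t_def)
    have "0 \<le> W - t\<^sup>2 * (\<mu> + 1)" using W_ge unfolding I_t by (simp add: power2_eq_square algebra_simps)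
    then have "(\<mu> + 1) * (t\<^sup>2 * (\<mu> + 1)) \<le> (\<mu> + 1) * W" using \<mu> by (intro mult_left_mono) auto
    then show ?thesis unfolding I_t by (simp add: power_mult_distrib power2_eq_square mult_ac)
  qed
  obtain k where k: "\<And>s \<mu> g e. 0 \<le> s \<Longrightarrow> comparable C s \<mu> g e \<Longrightarrow>
      \<bar>b\<bar> \<le> B * ((1 + s) * \<bar>g - b\<bar>) + k * (s - \<mu>)"
    unfolding B_def by (rule comparable_level[OF C]) blast
  have "\<bar>b\<bar> * \<mu> = (\<integral>x. \<bar>b\<bar> \<partial>M)" by (simp add: \<mu>_def)
  also have "\<dots> \<le> (\<integral>x. B * ((1 + u x) * \<bar>g x - b\<bar>) + k * (u x - w x) \<partial>M)"
    using int3 u(1,3) w(1) comp by (intro integral_mono k) auto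
  also have "\<dots> = B * I"
    using int3 u w by (simp add: I_def)
  finally have "(\<bar>b\<bar> * \<mu>)\<^sup>2 \<le> (B * I)\<^sup>2" using \<mu> by (intro power_mono) auto
  also have "\<dots> \<le> B\<^sup>2 * ((\<mu> + 1) * W)"
    using I_sq by (simp add: power_mult_distrib mult_left_mono)
  finally have "b\<^sup>2 * \<mu>\<^sup>2 \<le> B\<^sup>2 * ((\<mu> + 1) * W)" by (simp add: power_mult_distrib)
  then have "b\<^sup>2 \<le> B\<^sup>2 * ((\<mu> + 1) * W) / \<mu>\<^sup>2" using \<mu> by (simp add: field_simps)
  then have "(\<mu> + 1) * b\<^sup>2 \<le> (\<mu> + 1) * (B\<^sup>2 * ((\<mu> + 1) * W) / \<mu>\<^sup>2)" using \<mu> by (intro mult_left_mono) auto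
  also have "\<dots> = ((\<mu> + 1) * B / \<mu>)\<^sup>2 * W" by (simp add: power_mult_distrib power_divide power2_eq_square)
  finally have b_le: "(\<mu> + 1) * b\<^sup>2 \<le> ((\<mu> + 1) * B / \<mu>)\<^sup>2 * W" .
  have "(\<integral>\<^sup>+x. ennreal (e x) \<partial>M) \<le>
      (\<integral>\<^sup>+x. ennreal (2 * C * ((1 + u x) * (g x - b)\<^sup>2 + b\<^sup>2 * (1 + u x))) \<partial>M)"
  proof (intro nn_integral_mono ennreal_leI)
    fix x assume x: "x \<in> space M"
    have "(g x)\<^sup>2 \<le> 2 * (g x - b)\<^sup>2 + 2 * b\<^sup>2"
      using zero_le_power2[of "g x - 2 * b"] by (simp add: power2_eq_square algebra_simps)
    then have "(1 + u x) * (g x)\<^sup>2 \<le> (1 + u x) * (2 * (g x - b)\<^sup>2 + 2 * b\<^sup>2)"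
      using u(3)[OF x] by (intro mult_left_mono) auto
    then have "C * ((1 + u x) * (g x)\<^sup>2) \<le> C * ((1 + u x) * (2 * (g x - b)\<^sup>2 + 2 * b\<^sup>2))"
      by (rule mult_left_mono) (use C in simp)
    moreover have "e x \<le> C * ((1 + u x) * (g x)\<^sup>2)" using comp[OF x] by (simp add: comparable_def)
    ultimately show "e x \<le> 2 * C * ((1 + u x) * (g x - b)\<^sup>2 + b\<^sup>2 * (1 + u x))"
      by (simp add: algebra_simps)
  qed
  also have "\<dots> = ennreal (\<integral>x. 2 * C * ((1 + u x) * (g x - b)\<^sup>2 + b\<^sup>2 * (1 + u x)) \<partial>M)"
    using int1 int2 u(3) C by (intro nn_integral_eq_integral) (auto intro!: AE_I2)
  also have "(\<integral>x. 2 * C * ((1 + u x) * (g x - b)\<^sup>2 + b\<^sup>2 * (1 + u x)) \<partial>M) = 2 * C * (W + (\<mu> + 1) * b\<^sup>2)"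
    by (simp only: integral_mult_right_zero val1 W_def mult.commute[of "\<mu> + 1"]
        Bochner_Integration.integral_add[OF int2 integrable_mult_right[OF int1]])
  also have "ennreal \<dots> \<le> ennreal (2 * C * (1 + ((\<mu> + 1) * B / \<mu>)\<^sup>2) * W)"
    using mult_left_mono[OF b_le, of "2 * C"] C by (intro ennreal_leI) (simp add: algebra_simps)
  also have "\<dots> = ennreal (2 * C * (1 + ((\<mu> + 1) * B / \<mu>)\<^sup>2)) * ennreal W"
    using C by (intro ennreal_mult') auto
  finally show ?thesis by (simp only: W \<mu>_def B_def)
qed

text \<open>Integrability follows from the value of the integral: a non-integrable function has integral \<open>0\<close>.\<close>

lemma density_restrict_space:
  fixes u :: "'a::euclidean_space \<Rightarrow> real"
  assumes \<Omega>: "open \<Omega>" and cont: "continuous_on \<Omega> u" and one: "(LINT x:\<Omega>|lebesgue. u x) = 1"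
  shows "integrable (restrict_space lborel \<Omega>) u" "(\<integral>x. u x \<partial>restrict_space lborel \<Omega>) = 1"
proof -
  have meas: "(\<lambda>x. indicator \<Omega> x *\<^sub>R u x) \<in> borel_measurable lborel"
    using borel_measurable_continuous_on_indicator[OF borel_open[OF \<Omega>] cont] by simp
  have \<Omega>': "\<Omega> \<inter> space lborel \<in> sets lborel" using \<Omega> by simp
  have 1: "(\<integral>x. indicator \<Omega> x *\<^sub>R u x \<partial>lborel) = 1"
    using one integral_completion[OF meas] by (simp add: set_lebesgue_integral_def)
  then have "integrable lborel (\<lambda>x. indicator \<Omega> x *\<^sub>R u x)"
    using not_integrable_integral_eq by fastforce
  then show "integrable (restrict_space lborel \<Omega>) u" using integrable_restrict_space[OF \<Omega>'] by blast
  show "(\<integral>x. u x \<partial>restrict_space lborel \<Omega>) = 1" using 1 integral_restrict_space[OF \<Omega>'] by metis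
qed

text \<open>The part of the unit mass below the level \<open>\<eta>\<close> is at most \<open>1/2\<close>, so at least \<open>1/2\<close> lies above it; by
uniform integrability a set of measure at most \<open>\<delta>\<close> would carry at most \<open>1/4\<close>.\<close>

lemma superlevel_large:
  fixes u :: "'a::euclidean_space \<Rightarrow> real"
  assumes \<Omega>: "open \<Omega>" "bounded \<Omega>" and cont: "continuous_on \<Omega> u" and nonneg: "\<And>x. x \<in> \<Omega> \<Longrightarrow> 0 \<le> u x"
    and one: "(LINT x:\<Omega>|lebesgue. u x) = 1"
    and ui: "\<And>A. A \<in> sets lebesgue \<Longrightarrow> A \<subseteq> \<Omega> \<Longrightarrow> emeasure lebesgue A \<le> ennreal \<delta> \<Longrightarrow>
      (\<integral>\<^sup>+x\<in>A. ennreal \<bar>u x\<bar> \<partial>lebesgue) \<le> ennreal (1/4)"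
    and \<eta>: "0 < \<eta>" "\<eta> * measure lborel \<Omega> \<le> 1/2"
  shows "{x \<in> \<Omega>. \<eta> \<le> u x} \<in> sets borel" "ennreal \<delta> \<le> emeasure lborel {x \<in> \<Omega>. \<eta> \<le> u x}"
proof -
  define S where "S = {x \<in> \<Omega>. \<eta> \<le> u x}"
  have "S = \<Omega> - (\<Omega> \<inter> u -` {..<\<eta>})" by (auto simp: S_def)
  moreover have "open (\<Omega> \<inter> u -` {..<\<eta>})" by (rule continuous_open_preimage[OF cont \<Omega>(1)]) simp
  ultimately have S: "S \<in> sets borel" using \<Omega>(1) by auto
  then show "{x \<in> \<Omega>. \<eta> \<le> u x} \<in> sets borel" by (simp add: S_def)
  note [measurable] = S borel_open[OF \<Omega>(1)]
  have [measurable]: "(\<lambda>x. indicator \<Omega> x * u x) \<in> borel_measurable borel"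
    using borel_measurable_continuous_on_indicator[OF borel_open[OF \<Omega>(1)] cont] by simp
  have em: "emeasure lborel \<Omega> = ennreal (measure lborel \<Omega>)"
    using emeasure_bounded_finite[OF \<Omega>(2)] by (auto intro!: emeasure_eq_ennreal_measure)
  have "AE x in restrict_space lborel \<Omega>. 0 \<le> u x"
    using nonneg by (intro AE_I2) (simp add: space_restrict_space)
  then have "1 = (\<integral>\<^sup>+x. ennreal (u x) \<partial>restrict_space lborel \<Omega>)"
    using nn_integral_eq_integral[OF density_restrict_space(1)[OF \<Omega>(1) cont one]]
      density_restrict_space(2)[OF \<Omega>(1) cont one] by simp
  also have "\<dots> = (\<integral>\<^sup>+x\<in>\<Omega>. ennreal (u x) \<partial>lborel)"
    using \<Omega>(1) by (intro nn_integral_restrict_space) simp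
  also have "\<dots> \<le> (\<integral>\<^sup>+x. ennreal \<bar>indicator \<Omega> x * u x\<bar> * indicator S x + ennreal \<eta> * indicator \<Omega> x \<partial>lborel)"
    using nonneg by (intro nn_integral_mono) (auto simp: indicator_def S_def intro!: ennreal_leI)
  also have "\<dots> = (\<integral>\<^sup>+x\<in>S. ennreal \<bar>indicator \<Omega> x * u x\<bar> \<partial>lborel) + ennreal \<eta> * emeasure lborel \<Omega>"
    by (simp add: nn_integral_add nn_integral_cmult_indicator)
  also have "(\<integral>\<^sup>+x\<in>S. ennreal \<bar>indicator \<Omega> x * u x\<bar> \<partial>lborel) = (\<integral>\<^sup>+x\<in>S. ennreal \<bar>u x\<bar> \<partial>lborel)"
    by (intro nn_integral_cong) (auto simp: indicator_def S_def)
  also have "ennreal \<eta> * emeasure lborel \<Omega> \<le> ennreal (1/2)"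
    unfolding em ennreal_mult'[OF less_imp_le[OF \<eta>(1)], symmetric] by (rule ennreal_leI[OF \<eta>(2)])
  finally have large: "1 \<le> (\<integral>\<^sup>+x\<in>S. ennreal \<bar>u x\<bar> \<partial>lborel) + ennreal (1/2)" by (simp add: add_left_mono)
  have "\<not> emeasure lborel S \<le> ennreal \<delta>"
  proof
    assume "emeasure lborel S \<le> ennreal \<delta>"
    then have "(\<integral>\<^sup>+x\<in>S. ennreal \<bar>u x\<bar> \<partial>lebesgue) \<le> ennreal (1/4)"
      using S by (intro ui) (auto simp: S_def)
    then have "(\<integral>\<^sup>+x\<in>S. ennreal \<bar>u x\<bar> \<partial>lborel) \<le> ennreal (1/4)" by (simp add: nn_integral_completion)
    then have "1 \<le> ennreal (1/4) + ennreal (1/2)" using large by (meson add_right_mono order_trans)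
    also have "\<dots> = ennreal (3/4)" by (subst ennreal_plus[symmetric]) simp_all
    finally show False by (simp add: ennreal_1[symmetric] del: ennreal_1)
  qed
  then show "ennreal \<delta> \<le> emeasure lborel {x \<in> \<Omega>. \<eta> \<le> u x}" by (simp add: S_def)
qed

section \<open>The inequality on a bounded open set\<close>

context free_energy
begin

text \<open>The sum \<open>Q + A\<close> in the proof is the weighted integral \<open>\<integral> (1 + u) (g - b)\<^sup>2\<close>. It is at most a multiple of the right-hand side
by \<open>weighted_poincare\<close> and the properties of the truncation, and it bounds the energy by
\<open>comparable_integral_le\<close>.\<close>

lemma free_energy_inequality:
  assumes link: "linked \<Omega> \<Omega> \<Omega>" and m_one: "(LINT x:\<Omega>|lebesgue. m x) = 1"
    and u_C1: "\<And>u. u \<in> U \<Longrightarrow> \<exists>Du. continuous_on \<Omega> Du \<and> (\<forall>x\<in>\<Omega>. (u has_derivative (\<lambda>h. Du x \<bullet> h)) (at x))"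
    and u_nonneg: "\<And>u x. u \<in> U \<Longrightarrow> x \<in> \<Omega> \<Longrightarrow> 0 \<le> u x"
    and u_one: "\<And>u. u \<in> U \<Longrightarrow> (LINT x:\<Omega>|lebesgue. u x) = 1"
    and \<delta>: "0 < \<delta>"
    and ui: "\<And>u A. u \<in> U \<Longrightarrow> A \<in> sets lebesgue \<Longrightarrow> A \<subseteq> \<Omega> \<Longrightarrow> emeasure lebesgue A \<le> ennreal \<delta> \<Longrightarrow>
      (\<integral>\<^sup>+x\<in>A. ennreal \<bar>u x\<bar> \<partial>lebesgue) \<le> ennreal (1/4)"
  shows "\<exists>C>0. \<forall>u\<in>U. \<forall>a::real.
    (\<integral>\<^sup>+x\<in>\<Omega>. ennreal (E x (u x)) \<partial>lebesgue) \<le>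
      ennreal C *
        ((\<integral>\<^sup>+x\<in>\<Omega>. ennreal (u x * (f x (u x) - a)\<^sup>2) \<partial>lebesgue) +
         (\<integral>\<^sup>+x\<in>\<Omega>. ennreal (u x * (norm (grad (\<lambda>y. f y (u y)) x))\<^sup>2) \<partial>lebesgue))"
proof -
  define M where "M = restrict_space lborel \<Omega>"
  have \<Omega>': "\<Omega> \<inter> space lborel \<in> sets lborel" using open_dom by simp
  have sp: "space M = \<Omega>" by (simp add: M_def space_restrict_space)
  have nnM: "(\<integral>\<^sup>+x. h x \<partial>M) = (\<integral>\<^sup>+x\<in>\<Omega>. h x \<partial>lborel)" for h
    unfolding M_def by (rule nn_integral_restrict_space[OF \<Omega>'])
  define \<mu> where "\<mu> = measure lborel \<Omega>"
  have em: "emeasure lborel \<Omega> = ennreal \<mu>"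
    unfolding \<mu>_def using emeasure_bounded_finite[OF bounded_dom] by (auto intro!: emeasure_eq_ennreal_measure)
  have "emeasure lborel \<Omega> \<noteq> 0"
    using open_dom nonempty_dom open_not_negligible[of \<Omega>]
    by (auto simp: negligible_iff_null_sets null_sets_def null_sets_completion_iff)
  then have \<mu>: "0 < \<mu>" using em by (auto simp: \<mu>_def less_le)
  have emM: "emeasure M (space M) = ennreal \<mu>"
    using \<Omega>' em by (simp add: sp) (simp add: M_def emeasure_restrict_space)
  interpret M: finite_measure M by standard (simp add: emM)
  have \<mu>M: "measure M (space M) = \<mu>" using emM \<mu> by (simp add: measure_def)
  obtain K c C where K: "0 < K" and c: "0 < c" and C: "1 \<le> C"
    and large: "\<And>x s. x \<in> closure \<Omega> \<Longrightarrow> 0 < s \<Longrightarrow> s \<le> c \<Longrightarrow> K \<le> f x s"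
    and comp: "\<And>x s. x \<in> \<Omega> \<Longrightarrow> 0 \<le> s \<Longrightarrow> comparable C s (m x) (truncated_f K c x s) (E x s)"
    by (rule truncated_f_comparable) blast
  define \<eta> where "\<eta> = 1 / (2 * \<mu>)"
  have \<eta>: "0 < \<eta>" "\<eta> * measure lborel \<Omega> \<le> 1/2" using \<mu> by (auto simp: \<eta>_def \<mu>_def[symmetric])
  obtain P where P0: "0 \<le> P" and P: "\<forall>g G u b. C1_fun \<Omega> g G \<longrightarrow> (\<forall>x\<in>\<Omega>. 0 \<le> u x) \<longrightarrow>
    {x \<in> \<Omega>. \<eta> \<le> u x} \<in> sets borel \<longrightarrow> ennreal \<delta> \<le> emeasure lborel {x \<in> \<Omega>. \<eta> \<le> u x} \<longrightarrow>
    (\<integral>\<^sup>+x\<in>\<Omega>. ennreal ((g x - b)\<^sup>2) \<partial>lborel) \<le>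
      ennreal P * ((\<integral>\<^sup>+x\<in>\<Omega>. ennreal (u x * (g x - b)\<^sup>2) \<partial>lborel) + energy \<Omega> G)"
    using weighted_poincare[OF borel_open[OF open_dom] bounded_dom link \<eta>(1) \<delta>] by blast
  define X where "X = 2 * C * (1 + ((\<mu> + 1) * (1 + C\<^sup>2) / \<mu>)\<^sup>2)"
  have X: "0 < X" unfolding X_def using C by (intro mult_pos_pos add_pos_nonneg) auto
  define R where "R = X * ((P + 1) * (1 + 1 / c))"
  have R: "0 < R" unfolding R_def using X P0 c by (intro mult_pos_pos add_pos_nonneg add_nonneg_pos) auto
  have main: "(\<integral>\<^sup>+x\<in>\<Omega>. ennreal (E x (u x)) \<partial>lborel) \<le>
      ennreal R *
        ((\<integral>\<^sup>+x\<in>\<Omega>. ennreal (u x * (f x (u x) - a)\<^sup>2) \<partial>lborel) +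
         (\<integral>\<^sup>+x\<in>\<Omega>. ennreal (u x * (norm (grad (\<lambda>y. f y (u y)) x))\<^sup>2) \<partial>lborel))"
    (is "_ \<le> _ * (?A + ?D)") if uU: "u \<in> U" for u a
  proof -
    obtain Du where Du: "continuous_on \<Omega> Du" "\<And>x. x \<in> \<Omega> \<Longrightarrow> (u has_derivative (\<lambda>h. Du x \<bullet> h)) (at x)"
      using u_C1[OF uU] by blast
    have u_cont: "continuous_on \<Omega> u"
      by (intro continuous_at_imp_continuous_on ballI has_derivative_continuous[OF Du(2)])
    have m_cont': "continuous_on \<Omega> m" by (rule continuous_on_subset[OF m_cont closure_subset])
    note u0 = u_nonneg[OF uU]
    obtain g G where C1: "C1_fun \<Omega> g G" and g: "\<And>x. x \<in> \<Omega> \<Longrightarrow> g x = truncated_f K c x (u x)"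
      and G: "\<And>x. x \<in> \<Omega> \<Longrightarrow> c * (norm (G x))\<^sup>2 \<le> u x * (norm (grad (\<lambda>y. f y (u y)) x))\<^sup>2"
      using truncated_f_C1_fun[OF K c large Du(2) Du(1) u0] by blast
    have [measurable]: "g \<in> borel_measurable borel" "G \<in> borel_measurable borel" "\<Omega> \<in> sets borel"
      using C1 open_dom by (auto simp: C1_fun_def)
    have [measurable]: "(\<lambda>x. indicator \<Omega> x *\<^sub>R u x) \<in> borel_measurable borel"
      by (rule borel_measurable_continuous_on_indicator[OF borel_open[OF open_dom] u_cont])
    define b where "b = trunc K a"
    define Q where "Q = (\<integral>\<^sup>+x\<in>\<Omega>. ennreal ((g x - b)\<^sup>2) \<partial>lborel)"
    define A where "A = (\<integral>\<^sup>+x\<in>\<Omega>. ennreal (u x * (g x - b)\<^sup>2) \<partial>lborel)"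
    have A_le: "A \<le> ?A" unfolding A_def
    proof (intro nn_integral_mono)
      fix x
      show "ennreal (u x * (g x - b)\<^sup>2) * indicator \<Omega> x \<le> ennreal (u x * (f x (u x) - a)\<^sup>2) * indicator \<Omega> x"
      proof (cases "x \<in> \<Omega> \<and> 0 < u x")
        case True
        then have "g x = trunc K (f x (u x))"
          using large[OF in_closure, of x "u x"] K by (auto simp: g truncated_f_def trunc_const)
        then have "\<bar>g x - b\<bar> \<le> \<bar>f x (u x) - a\<bar>"
          unfolding b_def by (simp add: trunc_contraction[OF K])
        then have "(g x - b)\<^sup>2 \<le> (f x (u x) - a)\<^sup>2" by (simp add: abs_le_square_iff)
        then show ?thesis using True by (auto intro!: ennreal_leI mult_left_mono)
      next
        case False
        then have "x \<notin> \<Omega> \<or> u x = 0" using u0[of x] by auto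
        then show ?thesis by auto
      qed
    qed
    have "ennreal c * energy \<Omega> G = (\<integral>\<^sup>+x. ennreal c * (ennreal ((norm (G x))\<^sup>2) * indicator \<Omega> x) \<partial>lborel)"
      unfolding energy_def by (intro nn_integral_cmult[symmetric]) measurable
    also have "\<dots> \<le> ?D"
      using G c by (intro nn_integral_mono) (auto simp: indicator_def ennreal_mult[symmetric] intro!: ennreal_leI)
    finally have "ennreal (1 / c) * (ennreal c * energy \<Omega> G) \<le> ennreal (1 / c) * ?D"
      by (rule mult_left_mono) simp
    then have G_le: "energy \<Omega> G \<le> ennreal (1 / c) * ?D"
      using c by (simp add: mult.assoc[symmetric] ennreal_mult[symmetric])
    have "Q \<le> ennreal P * (A + energy \<Omega> G)"
      using P C1 u0 superlevel_large[OF open_dom bounded_dom u_cont u0 u_one[OF uU] ui[OF uU] \<eta>]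
      unfolding Q_def A_def by blast
    then have "Q + A \<le> ennreal P * (A + energy \<Omega> G) + (A + energy \<Omega> G)"
      by (intro add_mono) auto
    also have "\<dots> = ennreal (P + 1) * (A + energy \<Omega> G)" using P0 by (simp add: distrib_right)
    also have "\<dots> \<le> ennreal (P + 1) * (?A + ennreal (1 / c) * ?D)"
      by (intro mult_left_mono add_mono A_le G_le) auto
    also have "\<dots> \<le> ennreal (P + 1) * (ennreal (1 + 1 / c) * (?A + ?D))"
    proof -
      have "?A \<le> ennreal (1 + 1 / c) * ?A"
        using c mult_right_mono[of 1 "ennreal (1 + 1 / c)" ?A] by simp
      moreover have "ennreal (1 / c) * ?D \<le> ennreal (1 + 1 / c) * ?D"
        using c by (intro mult_right_mono ennreal_leI) auto
      ultimately show ?thesis by (intro mult_left_mono) (auto simp: distrib_left add_mono)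
    qed
    finally have QA: "Q + A \<le> ennreal (P + 1) * (ennreal (1 + 1 / c) * (?A + ?D))" .
    have "(\<integral>\<^sup>+x. ennreal ((1 + u x) * (g x - b)\<^sup>2) \<partial>M) =
        (\<integral>\<^sup>+x. ennreal ((g x - b)\<^sup>2) * indicator \<Omega> x + ennreal ((indicator \<Omega> x *\<^sub>R u x) * (g x - b)\<^sup>2) * indicator \<Omega> x \<partial>lborel)"
      unfolding nnM using u0
      by (intro nn_integral_cong) (auto simp: indicator_def distrib_right ennreal_plus[symmetric] simp del: ennreal_plus)
    also have "\<dots> = Q + (\<integral>\<^sup>+x\<in>\<Omega>. ennreal ((indicator \<Omega> x *\<^sub>R u x) * (g x - b)\<^sup>2) \<partial>lborel)"
      unfolding Q_def by (intro nn_integral_add) measurable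
    also have "(\<integral>\<^sup>+x\<in>\<Omega>. ennreal ((indicator \<Omega> x *\<^sub>R u x) * (g x - b)\<^sup>2) \<partial>lborel) = A"
      unfolding A_def by (intro nn_integral_cong) (auto simp: indicator_def)
    finally have W: "(\<integral>\<^sup>+x. ennreal ((1 + u x) * (g x - b)\<^sup>2) \<partial>M) = Q + A" .
    have "(\<integral>\<^sup>+x\<in>\<Omega>. ennreal (E x (u x)) \<partial>lborel) = (\<integral>\<^sup>+x. ennreal (E x (u x)) \<partial>M)" by (simp add: nnM)
    also have "\<dots> \<le> ennreal X * (\<integral>\<^sup>+x. ennreal ((1 + u x) * (g x - b)\<^sup>2) \<partial>M)"
      unfolding X_def \<mu>M[symmetric]
    proof (rule M.comparable_integral_le[OF C])
      show "0 < measure M (space M)" using \<mu> \<mu>M by simp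
      show "g \<in> borel_measurable M" unfolding M_def by (intro measurable_restrict_space1) simp
      show "integrable M u" "(\<integral>x. u x \<partial>M) = 1"
        unfolding M_def by (rule density_restrict_space[OF open_dom u_cont u_one[OF uU]])+
      show "integrable M m" "(\<integral>x. m x \<partial>M) = 1"
        unfolding M_def by (rule density_restrict_space[OF open_dom m_cont' m_one])+
      show "0 \<le> u x" "comparable C (u x) (m x) (g x) (E x (u x))" if "x \<in> space M" for x
        using u0[of x] comp[of x "u x"] that by (auto simp: sp g)
    qed
    also have "\<dots> \<le> ennreal X * (ennreal (P + 1) * (ennreal (1 + 1 / c) * (?A + ?D)))"
      unfolding W by (intro mult_left_mono QA) simp
    also have "\<dots> = ennreal R * (?A + ?D)"
    proof -
      have "ennreal R = ennreal X * (ennreal (P + 1) * ennreal (1 + 1 / c))"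
        unfolding R_def using X P0 by (simp only: ennreal_mult' less_imp_le add_nonneg_nonneg zero_le_one)
      then show ?thesis by (simp only: mult.assoc)
    qed
    finally show ?thesis .
  qed
  show ?thesis unfolding nn_integral_completion using R main by blast
qed

end

section \<open>Domain and torus\<close>

lemma Ck_on_subset: "Ck_on k S g \<Longrightarrow> T \<subseteq> S \<Longrightarrow> Ck_on k T g"
proof (induction k arbitrary: g)
  case 0
  then show ?case by (auto intro: continuous_on_subset)
next
  case (Suc k)
  then show ?case by (auto intro: has_derivative_subset) (meson has_derivative_subset subsetD)
qed

lemma smooth_on_C1:
  assumes "smooth_on S u" "open \<Omega>" "\<Omega> \<subseteq> S"
  shows "\<exists>Du. continuous_on \<Omega> Du \<and> (\<forall>x\<in>\<Omega>. (u has_derivative (\<lambda>h. Du x \<bullet> h)) (at x))"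
proof -
  have "Ck_on (Suc 0) \<Omega> u" using assms Ck_on_subset unfolding smooth_on_def by blast
  then obtain Du where D: "\<forall>x\<in>\<Omega>. (u has_derivative (\<lambda>h. Du x \<bullet> h)) (at x within \<Omega>)"
      "\<forall>b\<in>Basis. continuous_on \<Omega> (\<lambda>x. Du x \<bullet> b)"
    unfolding Ck_on.simps by blast
  have "continuous_on \<Omega> Du" using D(2) by (subst continuous_on_componentwise) blast
  moreover have "\<forall>x\<in>\<Omega>. (u has_derivative (\<lambda>h. Du x \<bullet> h)) (at x)"
  proof
    fix x assume "x \<in> \<Omega>"
    then show "(u has_derivative (\<lambda>h. Du x \<bullet> h)) (at x)"
      using D(1)[rule_format, OF \<open>x \<in> \<Omega>\<close>] at_within_open[OF \<open>x \<in> \<Omega>\<close> assms(2)] by simp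
  qed
  ultimately show ?thesis by blast
qed

text \<open>For the torus the open unit cube is taken. It is convex, so it is linked to itself directly.\<close>

lemma region_interior:
  fixes R :: "(real^'n) region"
  assumes "admissible R"
  shows "\<exists>\<Omega>. open \<Omega> \<and> bounded \<Omega> \<and> \<Omega> \<noteq> {} \<and> linked \<Omega> \<Omega> \<Omega> \<and> \<Omega> \<subseteq> pts R \<and> \<Omega> \<subseteq> cell R \<and>
    cell R \<in> sets borel \<and> (AE x in lborel. x \<in> cell R \<longleftrightarrow> x \<in> \<Omega>)"
proof (cases R)
  case (Domain \<Omega>)
  then have \<Omega>: "bounded_C1_domain \<Omega>" using assms by simp
  show ?thesis unfolding Domain
    by (rule exI[of _ \<Omega>]) (use \<Omega> linked_C1_domain[OF \<Omega>] in \<open>auto simp: bounded_C1_domain_def\<close>)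
next
  case Torus
  define Q where "Q = box 0 (1::real^'n)"
  have mem: "x \<in> Q \<longleftrightarrow> (\<forall>i. 0 < x $ i \<and> x $ i < 1)" for x by (simp add: Q_def mem_box_cart)
  have ne: "(\<chi> i. 1/2) \<in> Q" by (simp add: mem)
  have link: "linked Q Q Q"
  proof (rule linked_segments)
    show "closed_segment x y \<subseteq> Q" if "x \<in> Q" "y \<in> Q" for x y
      using closed_segment_subset[OF that] convex_box unfolding Q_def by blast
  qed (auto simp: Q_def bounded_box)
  have sub: "Q \<subseteq> cell Torus" by (auto simp: mem less_imp_le)
  have meas: "cell (Torus :: (real^'n) region) \<in> sets borel"
  proof -
    have "cell (Torus :: (real^'n) region) = (\<Inter>i. {x. 0 \<le> x $ i} \<inter> {x. x $ i < 1})" by auto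
    moreover have "{x :: real^'n. 0 \<le> x $ i} \<inter> {x. x $ i < 1} \<in> sets borel" for i
      by (intro sets.Int borel_closed borel_open closed_Collect_le open_Collect_less continuous_intros)
    ultimately show ?thesis by (auto intro!: sets.finite_INT)
  qed
  have "AE x in lborel. x \<notin> cbox 0 (1::real^'n) - box 0 1"
    by (rule AE_not_in[OF null_sets_cbox_Diff_box])
  then have ae: "AE x in lborel. x \<in> cell Torus \<longleftrightarrow> x \<in> Q"
  proof eventually_elim
    case (elim x)
    have "x \<in> cbox 0 1" if "x \<in> cell Torus" using that by (auto simp: mem_box_cart less_imp_le)
    then show ?case using elim sub unfolding Q_def by blast
  qed
  show ?thesis unfolding Torus
    by (rule exI[of _ Q]) (use link sub meas ae ne in \<open>auto simp: Q_def bounded_box open_box\<close>)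
qed

lemma uniformly_integrable_threshold:
  assumes "uniformly_integrable R U" "0 < \<epsilon>"
  shows "\<exists>\<delta>>0. \<forall>u\<in>U. \<forall>A\<in>sets lebesgue. A \<subseteq> cell R \<longrightarrow> emeasure lebesgue A \<le> ennreal \<delta> \<longrightarrow>
    (\<integral>\<^sup>+x\<in>A. ennreal \<bar>u x\<bar> \<partial>lebesgue) \<le> \<epsilon>"
proof -
  let ?I = "\<lambda>\<delta>::real. {\<integral>\<^sup>+x\<in>A. ennreal \<bar>u x\<bar> \<partial>lebesgue | u A.
      u \<in> U \<and> A \<in> sets lebesgue \<and> A \<subseteq> cell R \<and> emeasure lebesgue A \<le> ennreal \<delta>}"
  have "\<forall>\<^sub>F \<delta> in at_right 0. Sup (?I \<delta>) < \<epsilon>"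
    using order_tendstoD(2)[OF assms(1)[unfolded uniformly_integrable_def] assms(2)] .
  then obtain b where b: "0 < b" "\<And>\<delta>. 0 < \<delta> \<Longrightarrow> \<delta> < b \<Longrightarrow> Sup (?I \<delta>) < \<epsilon>"
    by (auto simp: eventually_at_right_field)
  show ?thesis
  proof (intro exI[of _ "b / 2"] conjI ballI impI)
    fix u A assume "u \<in> U" "A \<in> sets lebesgue" "A \<subseteq> cell R" "emeasure lebesgue A \<le> ennreal (b / 2)"
    then have "(\<integral>\<^sup>+x\<in>A. ennreal \<bar>u x\<bar> \<partial>lebesgue) \<le> Sup (?I (b / 2))"
      by (intro Sup_upper) blast
    also have "\<dots> < \<epsilon>" using b by simp
    finally show "(\<integral>\<^sup>+x\<in>A. ennreal \<bar>u x\<bar> \<partial>lebesgue) \<le> \<epsilon>" by (rule less_imp_le)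
  qed (use b in simp)
qed

theorem theorem2p1:
  fixes R :: "(real^'n) region"
    and E f :: "real^'n \<Rightarrow> real \<Rightarrow> real"
    and m :: "real^'n \<Rightarrow> real"
    and U :: "(real^'n \<Rightarrow> real) set"
  assumes "admissible R"
    and "\<And>u. 0 \<le> u \<Longrightarrow> descends R (\<lambda>x. E x u)"
    and "\<And>u. 0 < u \<Longrightarrow> descends R (\<lambda>x. f x u)"
    and "descends R m"
    and "continuous_on (closure (pts R) \<times> {0..}) (\<lambda>(x, u). E x u)"
    and "Ck_on 1 (closure (pts R) \<times> {0<..}) (\<lambda>(x, u). f x u)"
    and "continuous_on (closure (pts R)) m"
    and "(LINT x:cell R|lebesgue. m x) = 1"
    and "\<And>x u. x \<in> closure (pts R) \<Longrightarrow> 0 \<le> u \<Longrightarrow> 0 \<le> E x u"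
    and "\<And>x. x \<in> closure (pts R) \<Longrightarrow> 0 < m x"
    and "\<And>x. x \<in> pts R \<Longrightarrow> E x (m x) = 0"
    and "\<And>x u. x \<in> pts R \<Longrightarrow> 0 < u \<Longrightarrow> (E x has_real_derivative - f x u) (at u)"
    and "\<And>x u. x \<in> closure (pts R) \<Longrightarrow> 0 < u \<Longrightarrow> deriv (f x) u < 0"
    and "\<And>u. u \<in> U \<Longrightarrow> smooth_density R u"
    and "uniformly_integrable R U"
  shows "\<exists>C>0. \<forall>u\<in>U. \<forall>a::real.
    (\<integral>\<^sup>+x\<in>cell R. ennreal (E x (u x)) \<partial>lebesgue) \<le>
      ennreal C *
        ((\<integral>\<^sup>+x\<in>cell R. ennreal (u x * (f x (u x) - a)\<^sup>2) \<partial>lebesgue) +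
         (\<integral>\<^sup>+x\<in>cell R. ennreal (u x * (norm (grad (\<lambda>y. f y (u y)) x))\<^sup>2) \<partial>lebesgue))"
proof -
  obtain \<Omega> where \<Omega>: "open \<Omega>" "bounded \<Omega>" "\<Omega> \<noteq> {}" "linked \<Omega> \<Omega> \<Omega>" "\<Omega> \<subseteq> pts R" "\<Omega> \<subseteq> cell R"
      "cell R \<in> sets borel" "AE x in lborel. x \<in> cell R \<longleftrightarrow> x \<in> \<Omega>"
    using region_interior[OF assms(1)] by blast
  have cl: "closure \<Omega> \<subseteq> closure (pts R)" by (rule closure_mono[OF \<Omega>(5)])
  have cell_sub: "cell R \<subseteq> closure (pts R)" using closure_subset by (cases R) auto
  interpret free_energy \<Omega> E f m
  proof
    show "continuous_on (closure \<Omega> \<times> {0..}) (\<lambda>(x, u). E x u)"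
      by (rule continuous_on_subset[OF assms(5)]) (use cl in auto)
    show "Ck_on 1 (closure \<Omega> \<times> {0<..}) (\<lambda>(x, u). f x u)"
      by (rule Ck_on_subset[OF assms(6)]) (use cl in auto)
    show "continuous_on (closure \<Omega>) m" by (rule continuous_on_subset[OF assms(7) cl])
    fix x :: "real^'n" and u :: real
    show "0 \<le> E x u" if "x \<in> closure \<Omega>" "0 \<le> u" using assms(9) cl that by blast
    show "0 < m x" if "x \<in> closure \<Omega>" using assms(10) cl that by blast
    show "E x (m x) = 0" if "x \<in> \<Omega>" using assms(11) \<Omega>(5) that by blast
    show "(E x has_real_derivative - f x u) (at u)" if "x \<in> \<Omega>" "0 < u" using assms(12) \<Omega>(5) that by blast
    show "deriv (f x) u < 0" if "x \<in> closure \<Omega>" "0 < u" using assms(13) cl that by blast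
  qed (rule \<Omega>)+
  have LINT_eq: "(LINT x:cell R|lebesgue. h x) = (LINT x:\<Omega>|lebesgue. h x)"
    if cont: "continuous_on (closure (pts R)) h" for h :: "real^'n \<Rightarrow> real"
  proof (rule set_integral_cong_set)
    have meas: "set_borel_measurable lebesgue A h" if "A \<in> sets borel" "A \<subseteq> closure (pts R)" for A
      unfolding set_borel_measurable_def
      using borel_measurable_continuous_on_indicator[OF that(1) continuous_on_subset[OF cont that(2)]]
      by (intro measurable_completion) simp
    show "set_borel_measurable lebesgue (cell R) h" by (rule meas[OF \<Omega>(7) cell_sub])
    show "set_borel_measurable lebesgue \<Omega> h" using \<Omega>(1,6) cell_sub by (intro meas) auto
    show "AE x in lebesgue. (x \<in> \<Omega>) = (x \<in> cell R)"
      using AE_completion[OF \<Omega>(8)] by eventually_elim auto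
  qed
  have u_smooth: "smooth_on (closure (pts R)) u" "\<And>x. x \<in> closure (pts R) \<Longrightarrow> 0 \<le> u x"
      "(LINT x:cell R|lebesgue. u x) = 1" if "u \<in> U" for u
    using assms(14)[OF that] by (auto simp: smooth_density_def)
  have u_cont: "continuous_on (closure (pts R)) u" if "u \<in> U" for u
    using u_smooth(1)[OF that] unfolding smooth_on_def by (metis Ck_on.simps(1))
  have sub: "\<Omega> \<subseteq> closure (pts R)" using \<Omega>(6) cell_sub by blast
  obtain \<delta> where \<delta>: "0 < \<delta>" and ui: "\<forall>u\<in>U. \<forall>A\<in>sets lebesgue. A \<subseteq> cell R \<longrightarrow> emeasure lebesgue A \<le> ennreal \<delta> \<longrightarrow>
    (\<integral>\<^sup>+x\<in>A. ennreal \<bar>u x\<bar> \<partial>lebesgue) \<le> ennreal (1/4)"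
    using uniformly_integrable_threshold[OF assms(15), of "ennreal (1/4)"] by auto
  have "\<exists>C>0. \<forall>u\<in>U. \<forall>a::real.
    (\<integral>\<^sup>+x\<in>\<Omega>. ennreal (E x (u x)) \<partial>lebesgue) \<le>
      ennreal C *
        ((\<integral>\<^sup>+x\<in>\<Omega>. ennreal (u x * (f x (u x) - a)\<^sup>2) \<partial>lebesgue) +
         (\<integral>\<^sup>+x\<in>\<Omega>. ennreal (u x * (norm (grad (\<lambda>y. f y (u y)) x))\<^sup>2) \<partial>lebesgue))"
  proof (rule free_energy_inequality[OF \<Omega>(4) _ _ _ _ \<delta>])
    show "(LINT x:\<Omega>|lebesgue. m x) = 1" using LINT_eq[OF assms(7)] assms(8) by simp
    fix u assume u: "u \<in> U"
    show "\<exists>Du. continuous_on \<Omega> Du \<and> (\<forall>x\<in>\<Omega>. (u has_derivative (\<lambda>h. Du x \<bullet> h)) (at x))"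
      by (rule smooth_on_C1[OF u_smooth(1)[OF u] \<Omega>(1) sub])
    show "(LINT x:\<Omega>|lebesgue. u x) = 1" using LINT_eq[OF u_cont[OF u]] u_smooth(3)[OF u] by simp
    show "0 \<le> u x" if "x \<in> \<Omega>" for x using u_smooth(2)[OF u] that sub by blast
    show "(\<integral>\<^sup>+x\<in>A. ennreal \<bar>u x\<bar> \<partial>lebesgue) \<le> ennreal (1/4)"
      if "A \<in> sets lebesgue" "A \<subseteq> \<Omega>" "emeasure lebesgue A \<le> ennreal \<delta>" for A
      using ui u that \<Omega>(6) by blast
  qed
  moreover have "(\<integral>\<^sup>+x\<in>cell R. h x \<partial>lebesgue) = (\<integral>\<^sup>+x\<in>\<Omega>. h x \<partial>lebesgue)" for h
  proof (rule nn_integral_cong_AE)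
    show "AE x in lebesgue. h x * indicator (cell R) x = h x * indicator \<Omega> x"
      using AE_completion[OF \<Omega>(8)] by eventually_elim (auto simp: indicator_def)
  qed
  ultimately show ?thesis by simp
qed

end
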